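(* Let $\lambda_1,\lambda_2>0$, let $F(p)=\sqrt{\lambda_1^2p_1^2+\lambda_2^2p_2^2}$ for $p=(p_1,p_2)\in\mathbb{R}^2$, let $A\in\mathbb{R}$ and $\mathbf{p}_0\in\mathbb{R}^2\setminus\{(0,0)\}$. Then the minimization problem $$\inf_{\gamma\in\mathcal{S}_{A,\mathbf{p}_0}}E(\gamma)$$ has a unique solution (up to reparametrization), namely the curve $\gamma_\beta$ that is the integral curve, joining $\mathbf{p}_0$ to the origin, of the vector field $$V_\beta(p):=(\cos\beta)\,\Theta(p)-(\sin\beta)\,R(p),$$ where $\beta\in(0,\pi)$ is selected so that $$\frac{\tilde r(\mathbf{p}_0)}{\lambda_1+\lambda_2}\cot\beta=\tilde A .$$
   Context: For a Lipschitz curve $\gamma=(\gamma^{(1)},\gamma^{(2)}):[0,1]\to\mathbb{R}^2$: $E(\gamma)=\int_0^1F(\gamma)|\gamma'|\,dt$ and $\mathcal{P}(\gamma)=-\int_0^1\gamma^{(2)}(\gamma^{(1)})'\,dt$. The class $\mathcal{S}_{A,\mathbf{p}_0}$ consists of all locally Lipschitz $\gamma:[0,1]\to\mathbb{R}^2$ with $\gamma(0)=\mathbf{p}_0$, $\gamma(1)=(0,0)$, $\mathcal{P}(\gamma)=A$. (Both $E$ and $\mathcal P$ are invariant under reparametrization.) The setting is that of a quadratic potential $W(p)=p^TH_Wp=F(p)^2$ with $H_W$ symmetric positive definite with eigenvalues $\lambda_1^2,\lambda_2^2$; all points and curves are expressed in coordinates with respect to an orthonormal basis of eigenvectors of $H_W$.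 Define $$\tilde r(p)=\tfrac12(\lambda_1p_1^2+\lambda_2p_2^2),\quad R(p)=\frac{\nabla\tilde r(p)}{F(p)^2}=\frac{(\lambda_1p_1,\lambda_2p_2)}{F(p)^2},\quad \Theta(p)=\frac{(-\lambda_2p_2,\lambda_1p_1)}{F(p)^2},$$ and the $1$-forms $$\omega_0=-p_2\,dp_1,\qquad \omega_1=\frac{1}{\lambda_1+\lambda_2}\left(-\lambda_2p_2\,dp_1+\lambda_1p_1\,dp_2\right).$$ Set $\tilde A:=A-\int_{\gamma_0}(\omega_0-\omega_1)$, where $\gamma_0$ is the (unconstrained) $E$-minimizing curve from $\mathbf{p}_0$ to the origin (any curve from $\mathbf{p}_0$ to the origin gives the same value, since $d\omega_0=d\omega_1$). Equivalently, for every curve $\gamma$ from $\mathbf{p}_0$ to the origin, $\mathcal{P}(\gamma)=A$ if and only if $\int_\gamma\omega_1=\tilde A$. *)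

theory Defs
  imports "HOL-Analysis.Analysis"
begin

definition F :: "real \<Rightarrow> real \<Rightarrow> real^2 \<Rightarrow> real" where
  "F l1 l2 p = sqrt (l1\<^sup>2 * (p$1)\<^sup>2 + l2\<^sup>2 * (p$2)\<^sup>2)"

definition locally_lipschitz_on :: "real set \<Rightarrow> (real \<Rightarrow> real^2) \<Rightarrow> bool" where
  "locally_lipschitz_on X \<gamma> \<longleftrightarrow>
     (\<forall>t\<in>X. \<exists>e>0. \<exists>L. L-lipschitz_on (cball t e \<inter> X) \<gamma>)"

(* A Lipschitz curve is differentiable almost everywhere; vector_derivative is unspecified on the
   remaining null set, which does not affect the integrals below. *)
definition energy :: "real \<Rightarrow> real \<Rightarrow> (real \<Rightarrow> real^2) \<Rightarrow> real" where
  "energy l1 l2 \<gamma> = integral {0..1} (\<lambda>t. F l1 l2 (\<gamma> t) * norm (vector_derivative \<gamma> (at t)))"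

definition area :: "(real \<Rightarrow> real^2) \<Rightarrow> real" where
  "area \<gamma> = - integral {0..1} (\<lambda>t. \<gamma> t $ 2 * vector_derivative \<gamma> (at t) $ 1)"

definition curves_to_origin :: "real^2 \<Rightarrow> (real \<Rightarrow> real^2) set" where
  "curves_to_origin p0 = {\<gamma>. locally_lipschitz_on {0..1} \<gamma> \<and> \<gamma> 0 = p0 \<and> \<gamma> 1 = 0}"

definition constrained_curves :: "real \<Rightarrow> real^2 \<Rightarrow> (real \<Rightarrow> real^2) set" where
  "constrained_curves A p0 = {\<gamma> \<in> curves_to_origin p0. area \<gamma> = A}"

definition minimizes_energy_in ::
    "real \<Rightarrow> real \<Rightarrow> (real \<Rightarrow> real^2) set \<Rightarrow> (real \<Rightarrow> real^2) \<Rightarrow> bool" where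
  "minimizes_energy_in l1 l2 C \<gamma> \<longleftrightarrow>
     \<gamma> \<in> C \<and> (\<forall>\<delta>\<in>C. energy l1 l2 \<gamma> \<le> energy l1 l2 \<delta>)"

definition r_tilde :: "real \<Rightarrow> real \<Rightarrow> real^2 \<Rightarrow> real" where
  "r_tilde l1 l2 p = (1/2) * (l1 * (p$1)\<^sup>2 + l2 * (p$2)\<^sup>2)"

(* The fields R, Theta and V are only meaningful away from the origin. *)
definition R_field :: "real \<Rightarrow> real \<Rightarrow> real^2 \<Rightarrow> real^2" where
  "R_field l1 l2 p = (1 / (F l1 l2 p)\<^sup>2) *\<^sub>R vector [l1 * p$1, l2 * p$2]"

definition Theta_field :: "real \<Rightarrow> real \<Rightarrow> real^2 \<Rightarrow> real^2" where
  "Theta_field l1 l2 p = (1 / (F l1 l2 p)\<^sup>2) *\<^sub>R vector [- l2 * p$2, l1 * p$1]"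

definition V_field :: "real \<Rightarrow> real \<Rightarrow> real \<Rightarrow> real^2 \<Rightarrow> real^2" where
  "V_field l1 l2 \<beta> p = cos \<beta> *\<^sub>R Theta_field l1 l2 p - sin \<beta> *\<^sub>R R_field l1 l2 p"

(* A 1-form is a map taking a base point p and a tangent vector v to a real. *)
type_synonym one_form = "real^2 \<Rightarrow> real^2 \<Rightarrow> real"

definition omega0 :: one_form where
  "omega0 p v = - p$2 * v$1"

definition omega1 :: "real \<Rightarrow> real \<Rightarrow> one_form" where
  "omega1 l1 l2 p v = (1 / (l1 + l2)) * (- l2 * p$2 * v$1 + l1 * p$1 * v$2)"

definition line_integral :: "one_form \<Rightarrow> (real \<Rightarrow> real^2) \<Rightarrow> real" where
  "line_integral \<omega> \<gamma> = integral {0..1} (\<lambda>t. \<omega> (\<gamma> t) (vector_derivative \<gamma> (at t)))"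

(* A minimizer exists when l1, l2 > 0. It is only determined up to reparametrization, which does
   not change line integrals along it. *)
definition unconstrained_minimizer :: "real \<Rightarrow> real \<Rightarrow> real^2 \<Rightarrow> real \<Rightarrow> real^2" where
  "unconstrained_minimizer l1 l2 p0 =
     (SOME \<gamma>. minimizes_energy_in l1 l2 (curves_to_origin p0) \<gamma>)"

definition A_tilde :: "real \<Rightarrow> real \<Rightarrow> real \<Rightarrow> real^2 \<Rightarrow> real" where
  "A_tilde l1 l2 A p0 =
     A - line_integral (\<lambda>p v. omega0 p v - omega1 l1 l2 p v) (unconstrained_minimizer l1 l2 p0)"

(* The curve stays in the domain of V (the punctured plane) on [0,T) and reaches the origin,
   where V is singular, only in the limit t --> T. *)
definition integral_curve_to_origin ::
    "(real^2 \<Rightarrow> real^2) \<Rightarrow> real^2 \<Rightarrow> real \<Rightarrow> (real \<Rightarrow> real^2) \<Rightarrow> bool" where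
  "integral_curve_to_origin V p0 T \<eta> \<longleftrightarrow>
     0 < T \<and> continuous_on {0..T} \<eta> \<and> \<eta> 0 = p0 \<and> \<eta> T = 0 \<and>
     (\<forall>t\<in>{0..<T}. \<eta> t \<noteq> 0 \<and> (\<eta> has_vector_derivative V (\<eta> t)) (at t within {0..T}))"

(* The parameter change is only required to be nondecreasing: a Lipschitz curve may stand still
   on subintervals without affecting any of the functionals. *)
definition reparametrization_of :: "real \<Rightarrow> (real \<Rightarrow> real^2) \<Rightarrow> (real \<Rightarrow> real^2) \<Rightarrow> bool" where
  "reparametrization_of T \<eta> \<gamma> \<longleftrightarrow>
     (\<exists>\<phi>. continuous_on {0..1} \<phi> \<and> mono_on {0..1} \<phi> \<and> \<phi> ` {0..1} = {0..T} \<and>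
          (\<forall>t\<in>{0..1}. \<gamma> t = \<eta> (\<phi> t)))"

end

theory Submission
  imports Defs
begin

text \<open>
  The proof is a calibration argument. For an angle \<open>\<beta>\<close> consider the field \<open>F\<^sup>2 V\<close>, the combination
  \<open>cos \<beta> F\<^sup>2 \<Theta> - sin \<beta> F\<^sup>2 R\<close>. The two summands are orthogonal and \<open>F\<^sup>2 \<Theta>\<close>, \<open>F\<^sup>2 R\<close> both have length \<open>F\<close>, so
  the field has length \<open>F\<close> as well, and Cauchy-Schwarz gives \<open>F |\<gamma>'| \<ge> F\<^sup>2 V \<bullet> \<gamma>'\<close> along every curve. On the other
  hand \<open>F\<^sup>2 V \<bullet> v = (l1 + l2) cos \<beta> omega1(v) - sin \<beta> d r_tilde(v)\<close>. Integrating along a curve from \<open>p0\<close> to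
  the origin yields

    \<open>E(\<gamma>) \<ge> (l1 + l2) cos \<beta> \<integral> omega1 + sin \<beta> r_tilde(p0)\<close>   (\<open>energy_lower_bound\<close>).

  The form \<open>omega0 - omega1\<close> is exact, so prescribing the area amounts to prescribing \<open>\<integral> omega1\<close>
  (\<open>constrained_curves_eq\<close>): on the admissible class the right-hand side is a constant. Hence a curve of the
  class that attains the bound is a minimizer, and if there is one then all minimizers attain it.

  Equality means that the velocity is almost everywhere a nonnegative multiple of \<open>V\<close>. Since \<open>r_tilde\<close>
  decreases at the constant rate \<open>sin \<beta>\<close> along \<open>V\<close>, it serves as a clock: the time parameter of the integral
  curve through a point of level \<open>r\<close> is \<open>(r_tilde(p0) - r) / sin \<beta>\<close>. This identifies the calibrated
  curves with the monotone reparametrizations of the integral curve (\<open>calibrated_iff_reparametrization\<close>).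
  Along the integral curve \<open>omega1(V) = cos \<beta> / (l1 + l2)\<close>, and the total time is \<open>r_tilde(p0) / sin \<beta>\<close>, so
  \<open>\<integral> omega1 = r_tilde(p0) / (l1 + l2) cot \<beta>\<close>: the choice of \<open>\<beta>\<close> in the theorem says precisely that the curve
  belongs to the class.

  The integral curve itself is an explicit linear flow run at a different speed
  (\<open>integral_curve_exists\<close>). Its uniqueness, and that of calibrated curves, follows from Gronwall's inequality
  (\<open>flow_unique_up_to_speed\<close>). Admissible curves are merely Lipschitz; everything about them rests on
  the almost everywhere differentiability of Lipschitz functions of one variable and the corresponding
  fundamental theorem of calculus (\<open>lipschitz_has_integral_derivative\<close>), which are derived from the
  Radon-Nikodym theorem and Lebesgue's differentiation theorem.
\<close>

section \<open>Lipschitz functions as indefinite integrals\<close>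

text \<open>
  Needed to compare \<open>interval_measure f + interval_measure g\<close> with Lebesgue measure as measures, so
  that a generator argument applies to the sum.
\<close>

lemma sum_of_borel_measures:
  fixes M1 M2 :: "'a :: topological_space measure"
  assumes "sets M1 = sets borel" "sets M2 = sets borel"
  obtains M where "sets M = sets borel"
    "\<And>B. B \<in> sets borel \<Longrightarrow> emeasure M B = emeasure M1 B + emeasure M2 B"
proof
  define M where "M = measure_of UNIV (sets borel) (\<lambda>B. emeasure M1 B + emeasure M2 B)"
  show "sets M = sets borel"
    unfolding M_def by (metis sets.sigma_sets_eq sets_measure_of space_borel sets.space_closed)
  fix B :: "'a set"
  assume B: "B \<in> sets borel"
  show "emeasure M B = emeasure M1 B + emeasure M2 B"
  proof (rule emeasure_measure_of[OF M_def])
    show "sets (borel :: 'a measure) \<subseteq> Pow UNIV" by simp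
    show "B \<in> sets M" using B \<open>sets M = sets borel\<close> by simp
    show "positive (sets M) (\<lambda>B. emeasure M1 B + emeasure M2 B)"
      by (simp add: positive_def)
    show "countably_additive (sets M) (\<lambda>B. emeasure M1 B + emeasure M2 B)"
    proof (rule countably_additiveI)
      fix A :: "nat \<Rightarrow> 'a set"
      assume "range A \<subseteq> sets M" "disjoint_family A" "\<Union>(range A) \<in> sets M"
      then show "(\<Sum>i. emeasure M1 (A i) + emeasure M2 (A i)) =
          emeasure M1 (\<Union>(range A)) + emeasure M2 (\<Union>(range A))"
        using assms \<open>sets M = sets borel\<close>
        by (simp add: suminf_add[symmetric] suminf_emeasure)
    qed
  qed
qed

text \<open>
  Continuity makes the end points null, so open intervals have the same measure as half-open ones.
\<close>

lemma interval_measure_box: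
  fixes F :: "real \<Rightarrow> real"
  assumes "l \<le> u" "mono F" "continuous_on UNIV F"
  shows "emeasure (interval_measure F) {l<..<u} = F u - F l"
proof -
  have Icc: "emeasure (interval_measure F) {a..b} = F b - F a" if "a \<le> b" for a b
    using emeasure_interval_measure_Icc[OF that _ assms(3)] assms(2) by (auto simp: mono_def)
  have "{l, u} = {l..l} \<union> {u..u}" by auto
  moreover have "{x..x} \<in> null_sets (interval_measure F)" for x
    using Icc[of x x] by (simp add: null_sets_def)
  ultimately have "{l, u} \<in> null_sets (interval_measure F)"
    by (metis null_sets.Un)
  then have "emeasure (interval_measure F) ({l..u} - {l, u}) = emeasure (interval_measure F) {l..u}"
    by (intro emeasure_Diff_null_set) auto
  moreover have "{l..u} - {l, u} = {l<..<u}" by auto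
  ultimately show ?thesis using Icc[OF assms(1)] by simp
qed

text \<open>
  Both sides are Borel measures that give every open interval its length.
\<close>

lemma complementary_interval_measures:
  fixes f g :: "real \<Rightarrow> real"
  assumes "mono f" "continuous_on UNIV f" "mono g" "continuous_on UNIV g"
    and fg: "\<And>t. f t + g t = t" and B: "B \<in> sets borel"
  shows "emeasure (interval_measure f) B + emeasure (interval_measure g) B = emeasure lborel B"
proof -
  obtain M where M: "sets M = sets borel"
    "\<And>B. B \<in> sets borel \<Longrightarrow>
       emeasure M B = emeasure (interval_measure f) B + emeasure (interval_measure g) B"
    by (rule sum_of_borel_measures[of "interval_measure f" "interval_measure g"]) simp_all
  have "lborel = M"
  proof (rule lborel_eqI)
    fix l u :: real
    assume "\<And>b. b \<in> Basis \<Longrightarrow> l \<bullet> b \<le> u \<bullet> b"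
    then have lu: "l \<le> u" by simp
    have "f l \<le> f u" "g l \<le> g u" using assms lu by (auto simp: mono_def)
    then have "emeasure M {l<..<u} = ennreal ((f u - f l) + (g u - g l))"
      using assms lu M by (simp add: interval_measure_box ennreal_plus)
    also have "(f u - f l) + (g u - g l) = u - l"
      using fg[of l] fg[of u] by linarith
    finally show "emeasure M (box l u) = (\<Prod>b\<in>Basis. (u - l) \<bullet> b)" by (simp add: box_real)
  qed (use M in simp)
  then show ?thesis using M(2)[OF B] by simp
qed

text \<open>
  If neither \<open>f\<close> nor \<open>t - f t\<close> ever decreases, then \<open>f\<close> grows at most as fast as \<open>t\<close>: the Stieltjes
  measure of \<open>f\<close> is dominated by Lebesgue measure, because the complementary measure accounts for the
  rest. Its Radon-Nikodym density is the derivative that is sought.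
\<close>

lemma density_of_slow_function:
  fixes f :: "real \<Rightarrow> real"
  assumes "mono f" "continuous_on UNIV f" "mono (\<lambda>t. t - f t)"
  obtains g where "\<And>t. 0 \<le> g t" "\<And>a b. a \<le> b \<Longrightarrow> (g has_integral f b - f a) {a..b}"
proof -
  have "absolutely_continuous lborel (interval_measure f)"
    unfolding absolutely_continuous_def
  proof
    fix B assume "B \<in> null_sets (lborel :: real measure)"
    then have "emeasure lborel B = 0" "B \<in> sets borel" by (auto simp: null_sets_def)
    then have "emeasure (interval_measure f) B = 0"
      using complementary_interval_measures[of f "\<lambda>t. t - f t" B] assms
        continuous_on_diff[OF continuous_on_id assms(2)] by auto
    then show "B \<in> null_sets (interval_measure f)" using \<open>B \<in> sets borel\<close> by (simp add: null_sets_def)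
  qed
  then obtain h where h: "h \<in> borel_measurable lborel" "density lborel h = interval_measure f"
    using sigma_finite_measure.Radon_Nikodym[OF sigma_finite_lborel, of "interval_measure f"] by auto
  define g where "g = (\<lambda>x. enn2real (h x))"
  have int: "(g has_integral f b - f a) {a..b}" if "a \<le> b" for a b
  proof -
    have "f a \<le> f b" using assms(1) that by (simp add: mono_def)
    have nn: "(\<integral>\<^sup>+x. h x * indicator {a..b} x \<partial>lborel) = ennreal (f b - f a)"
      using emeasure_interval_measure_Icc[OF that _ assms(2)] assms(1) emeasure_density[OF h(1), of "{a..b}"] h(2)
      by (auto simp: mono_def)
    then have "AE x in lborel. h x * indicator {a..b} x \<noteq> \<infinity>"
      using h(1) by (intro nn_integral_PInf_AE) auto
    then have "(\<integral>\<^sup>+x. ennreal (g x * indicator {a..b} x) \<partial>lborel) =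
        (\<integral>\<^sup>+x. h x * indicator {a..b} x \<partial>lborel)"
      by (intro nn_integral_cong_AE) (auto simp: g_def indicator_def less_top)
    then have "((\<lambda>x. g x * indicator {a..b} x) has_integral f b - f a) UNIV"
      using nn h(1) \<open>f a \<le> f b\<close>
      by (intro nn_integral_has_integral) (auto simp: g_def)
    moreover have "(\<lambda>x. g x * indicator {a..b} x) = (\<lambda>x. if x \<in> {a..b} then g x else 0)"
      by (auto simp: fun_eq_iff)
    ultimately show ?thesis by (simp only: has_integral_restrict_UNIV)
  qed
  show ?thesis by (rule that[of g]) (use int in \<open>auto simp: g_def\<close>)
qed

text \<open>
  Adding a linear function and rescaling turns a Lipschitz function into one to which the previous
  density result applies.
\<close>

lemma lipschitz_indefinite_integral:
  fixes f :: "real \<Rightarrow> real"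
  assumes f: "L-lipschitz_on UNIV f"
  obtains g where "\<And>a b. g absolutely_integrable_on {a..b}"
    "\<And>a b. a \<le> b \<Longrightarrow> (g has_integral f b - f a) {a..b}"
proof -
  \<comment> \<open>A positive Lipschitz constant, also for constant functions.\<close>
  define K where "K = L + 1"
  have K: "K > 0" using lipschitz_on_nonneg[OF f] by (simp add: K_def)
  have lip: "\<bar>f x - f y\<bar> \<le> K * \<bar>x - y\<bar>" for x y
    using lipschitz_on_normD[OF f, of x y] lipschitz_on_nonneg[OF f]
      mult_right_mono[of L K "\<bar>x - y\<bar>"] by (auto simp: K_def)
  have cf: "continuous_on UNIV f" by (rule lipschitz_on_continuous_on[OF f])
  define q where "q = (\<lambda>t. f t / K)"
  have slope: "\<bar>q x - q y\<bar> \<le> \<bar>x - y\<bar>" for x y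
    using lip[of x y] K
    by (simp add: q_def diff_divide_distrib[symmetric] abs_divide divide_le_eq mult.commute)
  \<comment> \<open>Since q has Lipschitz constant 1, both (t + q t) / 2 and (t - q t) / 2 are nondecreasing,
    and they add up to t.\<close>
  define h where "h = (\<lambda>t. (t + q t) / 2)"
  have h1: "mono h" unfolding h_def
  proof (rule monoI)
    fix x y :: real assume "x \<le> y"
    then show "(x + q x) / 2 \<le> (y + q y) / 2"
      using slope[of x y] by argo
  qed
  have h2: "mono (\<lambda>t. t - h t)" unfolding h_def
  proof (rule monoI)
    fix x y :: real assume "x \<le> y"
    then show "x - (x + q x) / 2 \<le> y - (y + q y) / 2"
      using slope[of x y] by argo
  qed
  have h3: "continuous_on UNIV h" using K unfolding h_def q_def by (auto intro!: continuous_intros cf)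
  obtain g0 where g0: "\<And>t. 0 \<le> g0 t" "\<And>a b. a \<le> b \<Longrightarrow> (g0 has_integral h b - h a) {a..b}"
    using density_of_slow_function[OF h1 h3 h2] by blast
  define g where "g = (\<lambda>t. K * (2 * g0 t - 1))"
  show ?thesis
  proof (rule that[of g])
    fix a b :: real
    have "g0 integrable_on {a..b}"
      by (cases "a \<le> b") (use g0(2) in \<open>auto simp: integrable_on_def\<close>)
    then have "g0 absolutely_integrable_on {a..b}"
      using g0(1) by (intro nonnegative_absolutely_integrable_1) auto
    then show "g absolutely_integrable_on {a..b}"
      unfolding g_def by (intro set_integrable_mult_right set_integral_diff(1)) (auto simp: set_integrable_mult_right_iff)
  next
    fix a b :: real assume ab: "a \<le> b"
    have "((\<lambda>t. K * (2 * g0 t - 1)) has_integral K * (2 * (h b - h a) - (b - a))) {a..b}"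
      using ab has_integral_const_real[of "1::real" a b] g0(2)[OF ab]
      by (intro has_integral_mult_right has_integral_diff) auto
    also have "K * (2 * (h b - h a) - (b - a)) = f b - f a" using K by (simp add: h_def q_def field_simps)
    finally show "(g has_integral f b - f a) {a..b}" by (simp add: g_def)
  qed
qed

text \<open>
  Lebesgue's differentiation theorem, for averages over intervals that start at the point.
\<close>

lemma indefinite_integral_right_derivative_ae:
  fixes f g :: "real \<Rightarrow> real"
  assumes g: "\<And>a b. a \<le> b \<Longrightarrow> (g has_integral f b - f a) {a..b}"
  obtains N where "negligible N" "\<And>x. x \<notin> N \<Longrightarrow> (f has_real_derivative g x) (at_right x)"
proof -
  have "g integrable_on cbox a b" for a b
    by (cases "a \<le> b") (use g in \<open>auto simp: integrable_on_def\<close>)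
  then obtain N where N: "negligible N" "\<And>x e. \<lbrakk>x \<notin> N; 0 < e\<rbrakk> \<Longrightarrow>
     \<exists>d>0. \<forall>h. 0 < h \<and> h < d \<longrightarrow>
        norm (integral (cbox x (x + h *\<^sub>R One)) g /\<^sub>R h ^ DIM(real) - g x) < e"
    using integrable_ccontinuous_explicit[of g] by blast
  have "(f has_real_derivative g x) (at_right x)" if x: "x \<notin> N" for x
    unfolding has_field_derivative_iff
  proof (rule tendstoI)
    fix e :: real assume "0 < e"
    from N(2)[OF x this] obtain d where d: "d > 0" "\<And>h. 0 < h \<Longrightarrow> h < d \<Longrightarrow>
        \<bar>integral {x..x + h} g / h - g x\<bar> < e" by (auto simp: divide_inverse mult.commute)
    show "\<forall>\<^sub>F y in at_right x. dist ((f y - f x) / (y - x)) (g x) < e"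
      unfolding eventually_at_right[OF less_add_one]
    proof (intro exI[of _ "x + d"] conjI allI impI)
      fix y assume y: "x < y" "y < x + d"
      have "integral {x..y} g = f y - f x" using g[of x y] y by (auto intro: integral_unique)
      then show "dist ((f y - f x) / (y - x)) (g x) < e"
        using d(2)[of "y - x"] y by (simp add: dist_real_def)
    qed (use d in auto)
  qed
  with N(1) show ?thesis by (rule that)
qed

text \<open>
  Rademacher's theorem in dimension one. Averages to the right of a point give the right derivative;
  the left derivative of \<open>f\<close> at \<open>x\<close> is, up to sign, the right derivative of the reflected function
  \<open>f (- x)\<close> at \<open>- x\<close>.
\<close>

lemma lipschitz_UNIV_derivative_ae:
  fixes f :: "real \<Rightarrow> real"
  assumes f: "L-lipschitz_on UNIV f"
  obtains g N where "negligible N" "\<And>x. x \<notin> N \<Longrightarrow> (f has_real_derivative g x) (at x)"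
    "\<And>a b. g absolutely_integrable_on {a..b}"
    "\<And>a b. a \<le> b \<Longrightarrow> (g has_integral f b - f a) {a..b}"
proof -
  obtain g where g: "\<And>a b. g absolutely_integrable_on {a..b}"
    "\<And>a b. a \<le> b \<Longrightarrow> (g has_integral f b - f a) {a..b}"
    using lipschitz_indefinite_integral[OF f] by blast
  obtain N1 where N1: "negligible N1" "\<And>x. x \<notin> N1 \<Longrightarrow> (f has_real_derivative g x) (at_right x)"
    using indefinite_integral_right_derivative_ae[OF g(2)] by blast
  have "((\<lambda>x. - g (- x)) has_integral f (- b) - f (- a)) {a..b}" if "a \<le> b" for a b
    using has_integral_neg[OF has_integral_reflect_lemma_real[OF g(2)[of "-b" "-a"]]] that by simp
  then obtain N2 where N2: "negligible N2"
    "\<And>x. x \<notin> N2 \<Longrightarrow> ((\<lambda>x. f (- x)) has_real_derivative - g (- x)) (at_right x)"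
    using indefinite_integral_right_derivative_ae[of "\<lambda>x. - g (- x)" "\<lambda>x. f (- x)"] by blast
  have left: "(f has_real_derivative g x) (at_left x)" if "x \<notin> uminus ` N2" for x
  proof -
    have "- x \<notin> N2" using that by force
    then have "((\<lambda>x. f (- x)) has_real_derivative - g x) (at_right (- x))" using N2(2)[of "- x"] by simp
    then have "((\<lambda>y. (f (- y) - f x) / (y + x)) \<longlongrightarrow> - g x) (at_right (- x))"
      by (simp add: has_field_derivative_iff)
    then have "((\<lambda>y. (f y - f x) / (- y + x)) \<longlongrightarrow> - g x) (at_left x)"
      by (subst filterlim_at_left_to_right) simp
    then have "((\<lambda>y. - ((f y - f x) / (- y + x))) \<longlongrightarrow> - (- g x)) (at_left x)"
      by (rule tendsto_minus)
    moreover have "- ((f y - f x) / (- y + x)) = (f y - f x) / (y - x)" for y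
      by (metis minus_diff_eq minus_divide_right uminus_add_conv_diff)
    ultimately show ?thesis by (simp add: has_field_derivative_iff)
  qed
  have "negligible (uminus ` N2)"
    by (rule negligible_differentiable_image_negligible[OF order_refl N2(1)])
      (auto intro!: derivative_intros simp: differentiable_on_def)
  then have "negligible (N1 \<union> uminus ` N2)" using N1(1) by simp
  moreover have "(f has_real_derivative g x) (at x)" if "x \<notin> N1 \<union> uminus ` N2" for x
    using left[of x] N1(2)[of x] that
    by (auto simp: has_field_derivative_iff filterlim_at_split)
  ultimately show ?thesis using that g by blast
qed

section \<open>Lipschitz functions on a compact interval\<close>

lemma lipschitz_on_clamp_extension:
  fixes f :: "real \<Rightarrow> 'a::metric_space"
  assumes "L-lipschitz_on {a..b} f" "a \<le> b"
  shows "L-lipschitz_on UNIV (\<lambda>x. f (max a (min b x)))"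
proof (rule lipschitz_onI)
  fix x y :: real
  have "dist (f (max a (min b x))) (f (max a (min b y))) \<le> L * dist (max a (min b x)) (max a (min b y))"
    using assms by (intro lipschitz_onD) auto
  also have "\<dots> \<le> L * dist x y"
    using lipschitz_on_nonneg[OF assms(1)] by (intro mult_left_mono) (auto simp: dist_real_def)
  finally show "dist (f (max a (min b x))) (f (max a (min b y))) \<le> L * dist x y" .
qed (use lipschitz_on_nonneg[OF assms(1)] in simp)

lemma lipschitz_on_derivative_ae:
  fixes f :: "real \<Rightarrow> real"
  assumes f: "L-lipschitz_on {a..b} f" and ab: "a \<le> b"
  obtains g N where "negligible N" "\<And>x. x \<in> {a<..<b} - N \<Longrightarrow> (f has_real_derivative g x) (at x)"
    "g absolutely_integrable_on {a..b}" "(g has_integral f b - f a) {a..b}"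
proof -
  define h where "h = (\<lambda>x. f (max a (min b x)))"
  have "L-lipschitz_on UNIV h" unfolding h_def by (rule lipschitz_on_clamp_extension[OF f ab])
  then obtain g N where gN: "negligible N"
    "\<And>x. x \<notin> N \<Longrightarrow> (h has_real_derivative g x) (at x)"
    "\<And>a b. g absolutely_integrable_on {a..b}"
    "\<And>u v. u \<le> v \<Longrightarrow> (g has_integral h v - h u) {u..v}"
    by (rule lipschitz_UNIV_derivative_ae) (rule that)
  show ?thesis
  proof (rule that)
    show "negligible N" by (rule gN(1))
    show "g absolutely_integrable_on {a..b}" by (rule gN(3))
    show "(g has_integral f b - f a) {a..b}" using gN(4)[OF ab] ab by (simp add: h_def)
    fix x assume x: "x \<in> {a<..<b} - N"
    show "(f has_real_derivative g x) (at x)"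
    proof (rule has_field_derivative_transform_within_open)
      show "(h has_real_derivative g x) (at x)" using gN(2) x by simp
      show "h y = f y" if "y \<in> {a<..<b}" for y using that by (simp add: h_def)
    qed (use x in auto)
  qed
qed

text \<open>
  The fundamental theorem of calculus for Lipschitz functions: any function that agrees with the
  derivative off a null set integrates to the increment.
\<close>

lemma lipschitz_has_integral_derivative:
  fixes f :: "real \<Rightarrow> real"
  assumes f: "L-lipschitz_on {a..b} f" and ab: "a \<le> b" and N: "negligible N"
    and f': "\<And>x. x \<in> {a<..<b} - N \<Longrightarrow> (f has_real_derivative f' x) (at x)"
  shows "(f' has_integral f b - f a) {a..b}" "f' absolutely_integrable_on {a..b}"
proof -
  obtain g M where g: "negligible M" "\<And>x. x \<in> {a<..<b} - M \<Longrightarrow> (f has_real_derivative g x) (at x)"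
    "g absolutely_integrable_on {a..b}" "(g has_integral f b - f a) {a..b}"
    by (rule lipschitz_on_derivative_ae[OF f ab]) (rule that)
  have neg: "negligible (insert a (insert b (M \<union> N)))" using g(1) N by simp
  have eq: "f' x = g x" if "x \<in> {a..b} - insert a (insert b (M \<union> N))" for x
    using that f'[of x] g(2)[of x] by (auto intro: DERIV_unique)
  show "(f' has_integral f b - f a) {a..b}" by (rule has_integral_spike[OF neg eq g(4)])
  show "f' absolutely_integrable_on {a..b}" by (rule absolutely_integrable_spike[OF g(3) neg eq])
qed

lemma lipschitz_nonincreasing:
  fixes f :: "real \<Rightarrow> real"
  assumes "L-lipschitz_on {a..b} f" "a \<le> b" "negligible N"
    and "\<And>x. x \<in> {a<..<b} - N \<Longrightarrow> (f has_real_derivative f' x) (at x)"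
    and "\<And>x. x \<in> {a<..<b} - N \<Longrightarrow> f' x \<le> 0"
  shows "f b \<le> f a"
proof -
  have neg: "negligible (insert a (insert b N))" using assms(3) by simp
  have "(f' has_integral f b - f a) {a..b}"
    using assms(1-4) by (rule lipschitz_has_integral_derivative(1))
  then have "((\<lambda>x. if x \<in> insert a (insert b N) then 0 else f' x) has_integral f b - f a) {a..b}"
    by (rule has_integral_spike[OF neg, rotated]) simp
  then have "f b - f a \<le> 0" by (rule has_integral_le[OF _ has_integral_0]) (use assms(5) in auto)
  then show ?thesis by simp
qed

text \<open>
  Coordinatewise reduction to the real case. At points where \<open>f\<close> is not differentiable the value of
  \<open>vector_derivative\<close> is arbitrary, but these points form a null set.
\<close>

lemma lipschitz_vector_derivative_ae:
  fixes f :: "real \<Rightarrow> 'a::euclidean_space"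
  assumes f: "L-lipschitz_on {a..b} f" and ab: "a \<le> b"
  obtains N where "negligible N"
    "\<And>x. x \<in> {a<..<b} - N \<Longrightarrow> (f has_vector_derivative vector_derivative f (at x)) (at x)"
    "(\<lambda>x. vector_derivative f (at x)) absolutely_integrable_on {a..b}"
proof -
  have comp: "L-lipschitz_on {a..b} (\<lambda>x. f x \<bullet> i)" if "i \<in> Basis" for i
  proof (rule lipschitz_onI)
    fix x y assume xy: "x \<in> {a..b}" "y \<in> {a..b}"
    have "dist (f x \<bullet> i) (f y \<bullet> i) \<le> dist (f x) (f y)"
      using that by (metis Basis_le_norm dist_norm inner_diff_left real_norm_def)
    also have "\<dots> \<le> L * dist x y" using lipschitz_onD[OF f xy] .
    finally show "dist (f x \<bullet> i) (f y \<bullet> i) \<le> L * dist x y" .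
  qed (use lipschitz_on_nonneg[OF f] in simp)
  have "\<exists>g N. negligible N \<and>
      (\<forall>x \<in> {a<..<b} - N. ((\<lambda>x. f x \<bullet> i) has_real_derivative g x) (at x))" if "i \<in> Basis" for i
    using lipschitz_on_derivative_ae[OF comp[OF that] ab] by metis
  then obtain g N where N: "\<And>i. i \<in> Basis \<Longrightarrow> negligible (N i)"
    "\<And>i x. i \<in> Basis \<Longrightarrow> x \<in> {a<..<b} - N i \<Longrightarrow> ((\<lambda>x. f x \<bullet> i) has_real_derivative g i x) (at x)"
    by metis
  have neg: "negligible (\<Union>i\<in>Basis. N i)" using N(1) by (intro negligible_Union) auto
  have vd: "(f has_vector_derivative vector_derivative f (at x)) (at x)"
    if x: "x \<in> {a<..<b} - (\<Union>i\<in>Basis. N i)" for x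
  proof -
    have "(\<lambda>x. f x \<bullet> i) differentiable (at x)" if "i \<in> Basis" for i
      using N(2)[OF that, of x] x that by (auto simp: has_field_derivative_def differentiable_def)
    then have "f differentiable (at x)" by (subst differentiable_componentwise_within) auto
    then show ?thesis by (simp add: vector_derivative_works)
  qed
  have "(\<lambda>x. vector_derivative f (at x) \<bullet> i) absolutely_integrable_on {a..b}" if "i \<in> Basis" for i
    using vd that
    by (intro lipschitz_has_integral_derivative(2)[OF comp ab neg])
       (auto simp: has_real_derivative_iff_has_vector_derivative
             intro!: bounded_linear.has_vector_derivative[OF bounded_linear_inner_left])
  then have "(\<lambda>x. vector_derivative f (at x)) absolutely_integrable_on {a..b}"
    by (rule absolutely_integrable_componentwise)
  with neg vd show ?thesis by (rule that)
qed

lemma lipschitz_on_mult_real: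
  fixes f g :: "real \<Rightarrow> real"
  assumes f: "L-lipschitz_on {a..b} f" and g: "M-lipschitz_on {a..b} g"
  shows "\<exists>K. K-lipschitz_on {a..b} (\<lambda>x. f x * g x)"
proof -
  have "bounded (f ` {a..b})" "bounded (g ` {a..b})"
    using lipschitz_on_continuous_on[OF f] lipschitz_on_continuous_on[OF g]
    by (auto intro!: compact_imp_bounded compact_continuous_image)
  then obtain B C where B: "\<And>x. x \<in> {a..b} \<Longrightarrow> \<bar>f x\<bar> \<le> B" and C: "\<And>x. x \<in> {a..b} \<Longrightarrow> \<bar>g x\<bar> \<le> C"
    unfolding bounded_real by blast
  show ?thesis
  proof (cases "{a..b} = {}")
    case False
    then have BC: "0 \<le> B" "0 \<le> C" using B C abs_ge_zero order_trans by (metis ex_in_conv)+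
    have "(C * L + B * M)-lipschitz_on {a..b} (\<lambda>x. f x * g x)"
    proof (rule lipschitz_onI)
      fix x y assume xy: "x \<in> {a..b}" "y \<in> {a..b}"
      have "f x * g x - f y * g y = (f x - f y) * g x + f y * (g x - g y)" by (simp add: algebra_simps)
      then have "\<bar>f x * g x - f y * g y\<bar> \<le> \<bar>f x - f y\<bar> * \<bar>g x\<bar> + \<bar>f y\<bar> * \<bar>g x - g y\<bar>"
        by (metis abs_mult abs_triangle_ineq)
      also have "\<dots> \<le> (L * dist x y) * C + B * (M * dist x y)"
        using lipschitz_onD[OF f xy] lipschitz_onD[OF g xy] B[of y] C[of x] xy BC lipschitz_on_nonneg[OF f]
        by (intro add_mono mult_mono) (auto simp: dist_real_def)
      finally show "dist (f x * g x) (f y * g y) \<le> (C * L + B * M) * dist x y"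
        by (simp add: dist_real_def algebra_simps)
    qed (use BC lipschitz_on_nonneg[OF f] lipschitz_on_nonneg[OF g] in simp)
    then show ?thesis by blast
  qed auto
qed

lemma lipschitz_on_exp:
  fixes f :: "real \<Rightarrow> real"
  assumes f: "L-lipschitz_on {a..b} f"
  shows "\<exists>K. K-lipschitz_on {a..b} (\<lambda>x. exp (f x))"
proof -
  have "bounded (f ` {a..b})"
    using lipschitz_on_continuous_on[OF f] by (auto intro!: compact_imp_bounded compact_continuous_image)
  then obtain B where B: "\<And>x. x \<in> {a..b} \<Longrightarrow> \<bar>f x\<bar> \<le> B" unfolding bounded_real by blast
  have "(exp B)-lipschitz_on {..B} (exp :: real \<Rightarrow> real)"
    by (rule bounded_derivative_imp_lipschitz[where f' = "\<lambda>x. (*) (exp x)"])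
       (auto intro!: derivative_eq_intros onorm_bound simp: abs_mult mult_right_mono)
  then have "(exp B)-lipschitz_on (f ` {a..b}) (exp :: real \<Rightarrow> real)"
    by (rule lipschitz_on_subset) (use B in force)
  then show ?thesis using lipschitz_on_compose2[OF f] by blast
qed

lemma lipschitz_on_vec_nth:
  fixes f :: "'a::metric_space \<Rightarrow> real^'n"
  assumes f: "L-lipschitz_on X f"
  shows "L-lipschitz_on X (\<lambda>x. f x $ i)"
proof (rule lipschitz_onI)
  fix x y assume "x \<in> X" "y \<in> X"
  then show "dist (f x $ i) (f y $ i) \<le> L * dist x y"
    using lipschitz_onD[OF f] dist_vec_nth_le order_trans by blast
qed (use lipschitz_on_nonneg[OF f] in simp)

section \<open>The quadratic well and its calibration\<close>

lemma has_real_derivative_vec_nth: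
  "(\<gamma> has_vector_derivative v) (at t within X) \<Longrightarrow>
    ((\<lambda>t. \<gamma> t $ i) has_real_derivative v $ i) (at t within X)"
  using bounded_linear.has_vector_derivative[OF bounded_linear_vec_nth]
  by (simp add: has_real_derivative_iff_has_vector_derivative)

definition dr_tilde :: "real \<Rightarrow> real \<Rightarrow> one_form" where
  "dr_tilde l1 l2 p v = l1 * p$1 * v$1 + l2 * p$2 * v$2"

text \<open>
  This is the rescaled field \<open>F\<^sup>2 V\<close>. It is linear in \<open>p\<close> and has no singularity at the origin, and as
  a 1-form it is a combination of \<open>omega1\<close> and the exact form \<open>d r_tilde\<close>.
\<close>

definition calibration :: "real \<Rightarrow> real \<Rightarrow> real \<Rightarrow> real^2 \<Rightarrow> real^2" where
  "calibration l1 l2 \<beta> p =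
     cos \<beta> *\<^sub>R vector [- l2 * p$2, l1 * p$1] - sin \<beta> *\<^sub>R vector [l1 * p$1, l2 * p$2]"

locale quadratic_well =
  fixes l1 l2 :: real
  assumes l1_pos: "0 < l1" and l2_pos: "0 < l2"
begin

abbreviation (input) Fw :: "real^2 \<Rightarrow> real" where "Fw \<equiv> F l1 l2"
abbreviation (input) rt :: "real^2 \<Rightarrow> real" where "rt \<equiv> r_tilde l1 l2"

lemma F_squared: "(Fw p)\<^sup>2 = l1\<^sup>2 * (p$1)\<^sup>2 + l2\<^sup>2 * (p$2)\<^sup>2"
  by (simp add: F_def)

lemma F_nonneg [simp]: "0 \<le> Fw p"
  by (simp add: F_def)

lemma F_eq_0_iff [simp]: "Fw p = 0 \<longleftrightarrow> p = 0"
proof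
  assume "Fw p = 0"
  then have "l1\<^sup>2 * (p$1)\<^sup>2 + l2\<^sup>2 * (p$2)\<^sup>2 = 0" using F_squared[of p] by simp
  then have "l1\<^sup>2 * (p$1)\<^sup>2 = 0 \<and> l2\<^sup>2 * (p$2)\<^sup>2 = 0"
    by (subst (asm) add_nonneg_eq_0_iff) auto
  then show "p = 0" using l1_pos l2_pos by (simp add: vec_eq_iff forall_2)
qed (simp add: F_def)

lemma F_pos: "p \<noteq> 0 \<Longrightarrow> 0 < Fw p"
  using F_nonneg[of p] F_eq_0_iff[of p] by linarith

text \<open>
  \<open>F\<^sup>2\<close> and \<open>r_tilde\<close> are comparable quadratic forms. Every quantitative estimate near the origin,
  for the field as well as for the curves, comes from these two inequalities.
\<close>

lemma r_tilde_bounds: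
  "2 * min l1 l2 * rt p \<le> (Fw p)\<^sup>2" "(Fw p)\<^sup>2 \<le> 2 * (l1 + l2) * rt p"
proof -
  have "min l1 l2 * (l1 * (p$1)\<^sup>2) \<le> l1 * (l1 * (p$1)\<^sup>2)" "min l1 l2 * (l2 * (p$2)\<^sup>2) \<le> l2 * (l2 * (p$2)\<^sup>2)"
    "l1 * (l1 * (p$1)\<^sup>2) \<le> (l1 + l2) * (l1 * (p$1)\<^sup>2)" "l2 * (l2 * (p$2)\<^sup>2) \<le> (l1 + l2) * (l2 * (p$2)\<^sup>2)"
    using l1_pos l2_pos by (intro mult_right_mono; simp)+
  moreover have r: "2 * c * rt p = c * (l1 * (p$1)\<^sup>2) + c * (l2 * (p$2)\<^sup>2)" for c
    by (simp add: r_tilde_def field_simps)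
  moreover have "(Fw p)\<^sup>2 = l1 * (l1 * (p$1)\<^sup>2) + l2 * (l2 * (p$2)\<^sup>2)"
    unfolding F_squared by algebra
  ultimately show "2 * min l1 l2 * rt p \<le> (Fw p)\<^sup>2" "(Fw p)\<^sup>2 \<le> 2 * (l1 + l2) * rt p"
    using r[of "min l1 l2"] r[of "l1 + l2"] by linarith+
qed

lemma r_tilde_nonneg [simp]: "0 \<le> rt p"
  using l1_pos l2_pos by (simp add: r_tilde_def)

lemma r_tilde_eq_0_iff [simp]: "rt p = 0 \<longleftrightarrow> p = 0"
proof
  assume "rt p = 0"
  then have "(Fw p)\<^sup>2 \<le> 0" using r_tilde_bounds(2)[of p] by simp
  then show "p = 0" by simp
qed (simp add: r_tilde_def)

lemma r_tilde_0 [simp]: "rt 0 = 0" and F_0 [simp]: "Fw 0 = 0"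
  by simp_all

lemma r_tilde_pos: "p \<noteq> 0 \<Longrightarrow> 0 < rt p"
  using r_tilde_nonneg[of p] r_tilde_eq_0_iff[of p] by linarith

lemma F_le_norm: "Fw p \<le> (l1 + l2) * norm p"
proof -
  have "(Fw p)\<^sup>2 \<le> ((l1 + l2) * norm p)\<^sup>2"
  proof -
    have "l1\<^sup>2 \<le> (l1 + l2)\<^sup>2" "l2\<^sup>2 \<le> (l1 + l2)\<^sup>2" using l1_pos l2_pos by (auto intro: power_mono)
    then have "l1\<^sup>2 * (p$1)\<^sup>2 + l2\<^sup>2 * (p$2)\<^sup>2 \<le> (l1 + l2)\<^sup>2 * (p$1)\<^sup>2 + (l1 + l2)\<^sup>2 * (p$2)\<^sup>2"
      by (intro add_mono mult_right_mono) auto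
    also have "\<dots> = ((l1 + l2) * norm p)\<^sup>2"
      by (simp only: power_mult_distrib power2_norm_eq_inner)
         (simp add: inner_vec_def sum_2 power2_eq_square distrib_left)
    finally show ?thesis by (simp add: F_squared)
  qed
  then show ?thesis by (rule power2_le_imp_le) (use l1_pos l2_pos in simp)
qed

lemma F_ge_on_superlevel:
  assumes "c \<le> rt p"
  shows "sqrt (2 * min l1 l2 * c) \<le> Fw p"
proof (rule real_le_lsqrt)
  have "2 * min l1 l2 * c \<le> 2 * min l1 l2 * rt p"
    using assms l1_pos l2_pos by (intro mult_left_mono) auto
  also have "\<dots> \<le> (Fw p)\<^sup>2" by (rule r_tilde_bounds(1))
  finally show "2 * min l1 l2 * c \<le> (Fw p)\<^sup>2" .
qed simp

lemma norm_squared_le_r_tilde: "min l1 l2 * (norm p)\<^sup>2 \<le> 2 * rt p"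
proof -
  have "min l1 l2 * (p$1)\<^sup>2 \<le> l1 * (p$1)\<^sup>2" "min l1 l2 * (p$2)\<^sup>2 \<le> l2 * (p$2)\<^sup>2"
    by (intro mult_right_mono; simp)+
  then show ?thesis
    unfolding power2_norm_eq_inner
    by (simp add: r_tilde_def inner_vec_def sum_2 power2_eq_square distrib_left)
qed

lemma continuous_on_F: "continuous_on X Fw"
  unfolding F_def by (intro continuous_intros)

lemma r_tilde_has_derivative:
  assumes "(\<gamma> has_vector_derivative v) (at t within X)"
  shows "((\<lambda>t. rt (\<gamma> t)) has_real_derivative dr_tilde l1 l2 (\<gamma> t) v) (at t within X)"
proof -
  show ?thesis
    unfolding r_tilde_def dr_tilde_def
    by (auto intro!: derivative_eq_intros has_real_derivative_vec_nth[OF assms] simp: algebra_simps)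
qed

end

locale calibrated_well = quadratic_well +
  fixes \<beta> :: real
  assumes beta: "\<beta> \<in> {0<..<pi}"
begin

abbreviation (input) cal :: "real^2 \<Rightarrow> real^2" where "cal \<equiv> calibration l1 l2 \<beta>"
abbreviation (input) Vw :: "real^2 \<Rightarrow> real^2" where "Vw \<equiv> V_field l1 l2 \<beta>"

lemma sin_beta_pos: "0 < sin \<beta>"
  using beta by (simp add: sin_gt_zero)

lemma calibration_nth:
  "cal p $ 1 = - cos \<beta> * l2 * p$2 - sin \<beta> * l1 * p$1"
  "cal p $ 2 = cos \<beta> * l1 * p$1 - sin \<beta> * l2 * p$2"
  by (simp_all add: calibration_def)

lemma calibration_diff: "cal p - cal q = cal (p - q)"
  by (simp add: vec_eq_iff forall_2 calibration_nth algebra_simps)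

text \<open>
  What makes the field a calibration: the integral of the first term is prescribed by the
  area constraint, and the integral of the second depends on the end points alone.
\<close>

lemma calibration_inner:
  "cal p \<bullet> v = (l1 + l2) * cos \<beta> * omega1 l1 l2 p v - sin \<beta> * dr_tilde l1 l2 p v"
  using l1_pos l2_pos
  by (simp add: inner_vec_def sum_2 calibration_nth omega1_def dr_tilde_def) algebra

text \<open>
  The fields \<open>F\<^sup>2 \<Theta>\<close> and \<open>F\<^sup>2 R\<close> are orthogonal, both of length \<open>F\<close>, and the calibration is a rotation
  of this frame by \<open>\<beta>\<close>.
\<close>

lemma norm_calibration: "norm (cal p) = Fw p"
proof -
  have "(cal p $ 1)\<^sup>2 + (cal p $ 2)\<^sup>2 = ((sin \<beta>)\<^sup>2 + (cos \<beta>)\<^sup>2) * (l1\<^sup>2 * (p$1)\<^sup>2 + l2\<^sup>2 * (p$2)\<^sup>2)"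
    unfolding calibration_nth by algebra
  then have "(norm (cal p))\<^sup>2 = (Fw p)\<^sup>2"
    unfolding F_squared power2_norm_eq_inner
    by (simp add: inner_vec_def sum_2 power2_eq_square[symmetric])
  then show ?thesis by (rule power2_eq_imp_eq) simp_all
qed

lemma V_eq_calibration: "Vw p = (1 / (Fw p)\<^sup>2) *\<^sub>R cal p"
  by (simp add: V_field_def Theta_field_def R_field_def calibration_def scaleR_right_diff_distrib mult.commute)

lemma norm_V: "norm (Vw p) = 1 / Fw p"
  by (simp add: V_eq_calibration norm_calibration power2_eq_square)

lemma dr_tilde_V:
  assumes "p \<noteq> 0" shows "dr_tilde l1 l2 p (Vw p) = - sin \<beta>"
proof -
  have "dr_tilde l1 l2 p (Vw p) = (1 / (Fw p)\<^sup>2) * dr_tilde l1 l2 p (cal p)"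
    by (simp add: V_eq_calibration dr_tilde_def algebra_simps add_divide_distrib)
  also have "dr_tilde l1 l2 p (cal p) = - sin \<beta> * (Fw p)\<^sup>2"
    unfolding dr_tilde_def calibration_nth F_squared by algebra
  finally show ?thesis using F_pos[OF assms] assms by simp
qed

lemma omega1_V:
  assumes "p \<noteq> 0" shows "omega1 l1 l2 p (Vw p) = cos \<beta> / (l1 + l2)"
proof -
  have "omega1 l1 l2 p (Vw p) = (1 / (Fw p)\<^sup>2) * omega1 l1 l2 p (cal p)"
    by (simp add: V_eq_calibration omega1_def algebra_simps add_divide_distrib)
  also have "omega1 l1 l2 p (cal p) = cos \<beta> / (l1 + l2) * (Fw p)\<^sup>2"
  proof -
    have "- l2 * p $ 2 * cal p $ 1 + l1 * p $ 1 * cal p $ 2 = cos \<beta> * (Fw p)\<^sup>2"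
      unfolding calibration_nth F_squared by algebra
    then show ?thesis by (simp add: omega1_def)
  qed
  finally show ?thesis using F_pos[OF assms] assms by simp
qed

text \<open>
  \<open>V p\<close> is the image of \<open>calibration p\<close> under inversion in the unit circle, and inversion satisfies
  \<open>|u / |u|\<^sup>2 - w / |w|\<^sup>2| = |u - w| / (|u| |w|)\<close>. Thus \<open>V\<close> is Lipschitz on every set where \<open>F\<close> is bounded
  below.
\<close>

lemma V_distance:
  assumes "p \<noteq> 0" "q \<noteq> 0"
  shows "norm (Vw p - Vw q) = Fw (p - q) / (Fw p * Fw q)"
proof -
  define a b where "a = Fw p" and "b = Fw q"
  have ab: "a > 0" "b > 0" using F_pos assms by (auto simp: a_def b_def)
  have "(norm (Vw p - Vw q))\<^sup>2 = (norm (cal p))\<^sup>2 / a^4 + (norm (cal q))\<^sup>2 / b^4 - 2 * (cal p \<bullet> cal q) / (a\<^sup>2 * b\<^sup>2)"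
    unfolding power2_norm_eq_inner V_eq_calibration a_def[symmetric] b_def[symmetric]
    by (simp add: inner_diff_left inner_diff_right inner_commute power2_eq_square power4_eq_xxxx)
  also have "\<dots> = (a\<^sup>2 + b\<^sup>2 - 2 * (cal p \<bullet> cal q)) / (a\<^sup>2 * b\<^sup>2)"
    unfolding norm_calibration a_def[symmetric] b_def[symmetric]
    using ab by (simp add: field_simps power2_eq_square power4_eq_xxxx)
  also have "a\<^sup>2 + b\<^sup>2 - 2 * (cal p \<bullet> cal q) = (norm (cal p - cal q))\<^sup>2"
    by (simp add: a_def b_def norm_calibration[symmetric] power2_norm_eq_inner inner_diff_left inner_diff_right inner_commute)
  also have "\<dots> = (Fw (p - q))\<^sup>2" by (simp add: calibration_diff norm_calibration)
  finally have "(norm (Vw p - Vw q))\<^sup>2 = (Fw (p - q) / (a * b))\<^sup>2"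
    by (simp add: power_divide power_mult_distrib)
  then show ?thesis using ab by (simp add: a_def b_def power2_eq_iff_nonneg)
qed

lemma calibration_le: "cal p \<bullet> v \<le> Fw p * norm v"
  using norm_cauchy_schwarz[of "cal p" v] by (simp add: norm_calibration)

text \<open>
  Equality in the Cauchy-Schwarz inequality forces the velocity to be a nonnegative multiple of the
  field. The factor is read off from the rate at which \<open>r_tilde\<close> decreases.
\<close>

lemma calibration_eq_imp:
  assumes "p \<noteq> 0" and eq: "cal p \<bullet> v = Fw p * norm v"
  shows "v = (- dr_tilde l1 l2 p v / sin \<beta>) *\<^sub>R Vw p" "dr_tilde l1 l2 p v \<le> 0"
proof -
  have "norm (cal p) *\<^sub>R v = norm v *\<^sub>R cal p"
    using norm_cauchy_schwarz_eq[of "cal p" v] eq by (simp add: norm_calibration)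
  then have "Fw p *\<^sub>R v = norm v *\<^sub>R cal p" by (simp add: norm_calibration)
  then have "(1 / Fw p) *\<^sub>R (Fw p *\<^sub>R v) = (1 / Fw p) *\<^sub>R (norm v *\<^sub>R cal p)" by simp
  then have v: "v = (norm v * Fw p) *\<^sub>R Vw p"
    using F_pos[OF assms(1)] assms(1) by (simp add: V_eq_calibration power2_eq_square)
  define k where "k = norm v * Fw p"
  have "k \<ge> 0" by (simp add: k_def)
  have "dr_tilde l1 l2 p v = k * dr_tilde l1 l2 p (Vw p)"
    by (subst v) (simp add: k_def dr_tilde_def algebra_simps)
  then have "dr_tilde l1 l2 p v = - k * sin \<beta>" using dr_tilde_V[OF assms(1)] by simp
  then show "v = (- dr_tilde l1 l2 p v / sin \<beta>) *\<^sub>R Vw p" "dr_tilde l1 l2 p v \<le> 0"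
    using v sin_beta_pos \<open>k \<ge> 0\<close> by (simp_all add: k_def)
qed

end

section \<open>Existence of the integral curve\<close>

text \<open>
  The solutions of \<open>S'' = - d S\<close> are hyperbolic, affine or trigonometric according to the sign of \<open>d\<close>.
\<close>

lemma sine_like_pair_exists:
  fixes d :: real
  obtains S C :: "real \<Rightarrow> real" where "S 0 = 0" "C 0 = 1"
    "\<And>s. (S has_real_derivative C s) (at s)" "\<And>s. (C has_real_derivative - d * S s) (at s)"
proof (cases d "0 :: real" rule: linorder_cases)
  case less
  define w where "w = sqrt (- d)"
  have "w > 0" and d: "d = - (w * w)" using less by (simp_all add: w_def)
  then show ?thesis
    by (intro that[of "\<lambda>s. sinh (w * s) / w" "\<lambda>s. cosh (w * s)"])
       (auto intro!: derivative_eq_intros simp: d field_simps)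
next
  case equal
  then show ?thesis
    by (intro that[of "\<lambda>s. s" "\<lambda>s. 1"]) (auto intro!: derivative_eq_intros)
next
  case greater
  define w where "w = sqrt d"
  have "w > 0" and d: "d = w * w" using greater by (simp_all add: w_def)
  then show ?thesis
    by (intro that[of "\<lambda>s. sin (w * s) / w" "\<lambda>s. cos (w * s)"])
       (auto intro!: derivative_eq_intros simp: d field_simps)
qed

context calibrated_well
begin

lemma calibration_linear_combination: "cal (a *\<^sub>R p + b *\<^sub>R q) = a *\<^sub>R cal p + b *\<^sub>R cal q"
  by (simp add: vec_eq_iff forall_2 calibration_nth algebra_simps)

lemma calibration_Cayley_Hamilton:
  "cal (cal p) = (- sin \<beta> * (l1 + l2)) *\<^sub>R cal p - (l1 * l2) *\<^sub>R p"
proof -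
  have "(sin \<beta>)\<^sup>2 + (cos \<beta>)\<^sup>2 = 1" by simp
  then show ?thesis
    unfolding vec_eq_iff forall_2 vector_minus_component vector_scaleR_component calibration_nth
      real_scaleR_def by algebra
qed

text \<open>
  Up to a positive factor \<open>V\<close> is the linear field \<open>calibration\<close>, so its trajectories are those of a
  linear system. By the Cayley-Hamilton theorem the exponential of a 2 by 2 matrix \<open>M\<close> with
  trace \<open>\<tau>\<close> and determinant \<open>\<delta>\<close> has the form \<open>f(s) 1 + g(s) M\<close>, where \<open>g'' = \<tau> g' - \<delta> g\<close> and
  \<open>f = g' - \<tau> g\<close>.
\<close>

lemma linear_flow_exists:
  obtains x where "x 0 = p0" "\<And>s. (x has_vector_derivative cal (x s)) (at s)"
proof -
  define \<tau> \<delta> where "\<tau> = - sin \<beta> * (l1 + l2)" and "\<delta> = l1 * l2"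
  define a where "a = \<tau> / 2"
  obtain S C where S0: "S 0 = 0" and C0: "C 0 = 1"
    and S: "\<And>s. (S has_real_derivative C s) (at s)"
    and C: "\<And>s. (C has_real_derivative - (\<delta> - a\<^sup>2) * S s) (at s)"
    by (rule sine_like_pair_exists[of "\<delta> - a\<^sup>2"]) (rule that)
  \<comment> \<open>The factor exp (a s) removes the first-order term of the equation for g.\<close>
  define f g where "f = (\<lambda>s. exp (a * s) * (C s - a * S s))" and "g = (\<lambda>s. exp (a * s) * S s)"
  have f': "(f has_real_derivative - \<delta> * g s) (at s)" for s
    unfolding f_def g_def
    by (auto intro!: derivative_eq_intros S C simp: algebra_simps power2_eq_square)
  have g': "(g has_real_derivative f s + \<tau> * g s) (at s)" for s
    unfolding f_def g_def
    by (auto intro!: derivative_eq_intros S C simp: algebra_simps a_def)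
  define x where "x = (\<lambda>s. f s *\<^sub>R p0 + g s *\<^sub>R cal p0)"
  show ?thesis
  proof (rule that[of x])
    show "x 0 = p0" by (simp add: x_def f_def g_def S0 C0)
    fix s
    have "(x has_vector_derivative (- \<delta> * g s) *\<^sub>R p0 + (f s + \<tau> * g s) *\<^sub>R cal p0) (at s)"
      unfolding x_def using f' g'
      by (auto intro!: derivative_eq_intros)
    also have "(- \<delta> * g s) *\<^sub>R p0 + (f s + \<tau> * g s) *\<^sub>R cal p0 = cal (x s)"
      unfolding x_def calibration_linear_combination calibration_Cayley_Hamilton
      by (simp add: \<tau>_def \<delta>_def algebra_simps)
    finally show "(x has_vector_derivative cal (x s)) (at s)" .
  qed
qed

lemma r_tilde_linear_flow:
  assumes "\<And>s. (x has_vector_derivative cal (x s)) (at s)"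
  shows "((\<lambda>s. rt (x s)) has_real_derivative - sin \<beta> * (Fw (x s))\<^sup>2) (at s)"
proof -
  have "dr_tilde l1 l2 p (cal p) = - sin \<beta> * (Fw p)\<^sup>2" for p
    unfolding dr_tilde_def calibration_nth F_squared by algebra
  then show ?thesis using r_tilde_has_derivative[OF assms] by metis
qed

text \<open>
  Along the linear flow \<open>r_tilde\<close> satisfies \<open>r' = - sin \<beta> F\<^sup>2\<close>, and \<open>F\<^sup>2\<close> lies between two multiples of
  \<open>r\<close>; hence \<open>r\<close> decays at least as fast as one exponential and at most as fast as another.
\<close>

lemma r_tilde_linear_flow_bounds:
  assumes x: "\<And>s. (x has_vector_derivative cal (x s)) (at s)" and "s \<le> t"
  shows "rt (x t) * exp (2 * min l1 l2 * sin \<beta> * t) \<le> rt (x s) * exp (2 * min l1 l2 * sin \<beta> * s)"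
    and "rt (x s) * exp (2 * (l1 + l2) * sin \<beta> * s) \<le> rt (x t) * exp (2 * (l1 + l2) * sin \<beta> * t)"
proof -
  have D: "((\<lambda>s. rt (x s) * exp (2 * c * sin \<beta> * s)) has_real_derivative
      sin \<beta> * exp (2 * c * sin \<beta> * s) * (2 * c * rt (x s) - (Fw (x s))\<^sup>2)) (at s)" for c s
    by (auto intro!: derivative_eq_intros r_tilde_linear_flow[OF x] simp: algebra_simps)
  show "rt (x t) * exp (2 * min l1 l2 * sin \<beta> * t) \<le> rt (x s) * exp (2 * min l1 l2 * sin \<beta> * s)"
  proof (rule DERIV_nonpos_imp_nonincreasing[OF \<open>s \<le> t\<close>])
    fix u
    have "sin \<beta> * exp (2 * min l1 l2 * sin \<beta> * u) * (2 * min l1 l2 * rt (x u) - (Fw (x u))\<^sup>2) \<le> 0"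
      using sin_beta_pos r_tilde_bounds(1)[of "x u"] by (intro mult_nonneg_nonpos) auto
    then show "\<exists>y. ((\<lambda>s. rt (x s) * exp (2 * min l1 l2 * sin \<beta> * s)) has_real_derivative y) (at u) \<and> y \<le> 0"
      using D by blast
  qed
  show "rt (x s) * exp (2 * (l1 + l2) * sin \<beta> * s) \<le> rt (x t) * exp (2 * (l1 + l2) * sin \<beta> * t)"
  proof (rule DERIV_nonneg_imp_nondecreasing[OF \<open>s \<le> t\<close>])
    fix u
    have "0 \<le> sin \<beta> * exp (2 * (l1 + l2) * sin \<beta> * u) * (2 * (l1 + l2) * rt (x u) - (Fw (x u))\<^sup>2)"
      using sin_beta_pos r_tilde_bounds(2)[of "x u"] by (intro mult_nonneg_nonneg) auto
    then show "\<exists>y. ((\<lambda>s. rt (x s) * exp (2 * (l1 + l2) * sin \<beta> * s)) has_real_derivative y) (at u) \<and> 0 \<le> y"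
      using D by blast
  qed
qed

text \<open>
  The faster exponential bounds \<open>r_tilde\<close> from below forward in time, the slower one backward in time.
\<close>

lemma linear_flow_nonzero:
  assumes x: "\<And>s. (x has_vector_derivative cal (x s)) (at s)" and "x 0 \<noteq> 0"
  shows "x s \<noteq> 0"
proof
  assume "x s = 0"
  moreover have "0 < rt (x 0)" using assms(2) by (rule r_tilde_pos)
  ultimately show False
    using r_tilde_linear_flow_bounds(1)[OF x, of s 0] r_tilde_linear_flow_bounds(2)[OF x, of 0 s]
    by (cases "s \<le> 0") auto
qed

text \<open>
  The exponential bounds show that \<open>r_tilde\<close> passes below and above every positive level.
\<close>

lemma linear_flow_attains_level:
  assumes x: "\<And>s. (x has_vector_derivative cal (x s)) (at s)" and "x 0 \<noteq> 0" and c: "0 < c"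
  shows "\<exists>s. rt (x s) = c"
proof -
  define k where "k = 2 * min l1 l2 * sin \<beta>"
  have k: "k > 0" using l1_pos l2_pos sin_beta_pos by (simp add: k_def)
  have r0: "0 < rt (x 0)" using assms(2) by (rule r_tilde_pos)
  \<comment> \<open>The time at which the bound rt (x 0) exp (- k s) equals c; it is negative when the level c
    lies above the initial one.\<close>
  define s1 where "s1 = ln (rt (x 0) / c) / k"
  have e: "exp (k * s1) = rt (x 0) / c" using k c r0 by (simp add: s1_def)
  have cont: "continuous_on A (\<lambda>s. rt (x s))" for A
    by (rule DERIV_continuous_on[OF has_field_derivative_at_within[OF r_tilde_linear_flow[OF x]]])
  show ?thesis
  proof (cases "0 \<le> s1")
    case True
    then have "1 \<le> exp (k * s1)" using k by simp
    then have "c \<le> rt (x 0)" using c by (simp add: e)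
    moreover have "rt (x s1) * exp (k * s1) \<le> rt (x 0)"
      using r_tilde_linear_flow_bounds(1)[OF x True] by (simp add: k_def)
    then have "rt (x s1) \<le> c" using r0 c by (simp add: e field_simps)
    ultimately show ?thesis using IVT2'[of "\<lambda>s. rt (x s)" s1 c 0] True cont by blast
  next
    case False
    then have "exp (k * s1) \<le> 1" using k by (simp add: mult_le_0_iff)
    then have "rt (x 0) \<le> c" using c by (simp add: e)
    moreover have "rt (x 0) \<le> rt (x s1) * exp (k * s1)"
      using r_tilde_linear_flow_bounds(1)[OF x, of s1 0] False by (simp add: k_def)
    then have "c \<le> rt (x s1)" using r0 c by (simp add: e field_simps)
    ultimately show ?thesis using IVT2'[of "\<lambda>s. rt (x s)" 0 c s1] False cont by force
  qed
qed

text \<open>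
  Along \<open>V\<close> the function \<open>r_tilde\<close> decreases at the constant rate \<open>sin \<beta>\<close>. The time parameter \<open>\<tau>\<close> of the
  integral curve is therefore \<open>(r_tilde p0 - r_tilde) / sin \<beta>\<close>, an increasing function of the time
  \<open>s\<close> of the linear flow that maps the real line onto the half-line below \<open>T = r_tilde p0 / sin \<beta>\<close>.
  Composing the linear flow with the inverse function gives the curve. Working on the whole
  line instead of \<open>s \<ge> 0\<close> makes \<open>\<tau> = 0\<close> an interior point.
\<close>

lemma integral_curve_exists:
  assumes "p0 \<noteq> 0"
  obtains \<eta> where "integral_curve_to_origin Vw p0 (rt p0 / sin \<beta>) \<eta>"
proof -
  define T where "T = rt p0 / sin \<beta>"
  have r0: "0 < rt p0" using assms by (rule r_tilde_pos)
  have T: "0 < T" using r0 sin_beta_pos by (simp add: T_def)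
  obtain x where x0: "x 0 = p0" and x: "\<And>s. (x has_vector_derivative cal (x s)) (at s)"
    by (rule linear_flow_exists[of p0]) (rule that)
  have nz: "x s \<noteq> 0" for s using linear_flow_nonzero[OF x] assms x0 by simp
  define f where "f = (\<lambda>s. (rt p0 - rt (x s)) / sin \<beta>)"
  have f': "(f has_real_derivative (Fw (x s))\<^sup>2) (at s)" for s
    unfolding f_def using sin_beta_pos
    by (auto intro!: derivative_eq_intros r_tilde_linear_flow[OF x])
  have "strict_mono f"
    using DERIV_pos_imp_increasing[of _ _ f] f' F_pos[OF nz]
    by (intro strict_monoI) (meson zero_less_power)
  then have inj: "inj f" by (rule strict_mono_imp_inj_on)
  define g where "g = inv f"
  have gf: "g (f s) = s" for s using inj by (simp add: g_def)
  have fg: "f (g \<tau>) = \<tau>" if "\<tau> < T" for \<tau>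
  proof -
    have "0 < rt p0 - sin \<beta> * \<tau>" using that sin_beta_pos by (simp add: T_def field_simps)
    then obtain s where "rt (x s) = rt p0 - sin \<beta> * \<tau>"
      using linear_flow_attains_level[OF x] assms x0 by blast
    then have "f s = \<tau>" using sin_beta_pos by (simp add: f_def)
    then show ?thesis using gf[of s] by simp
  qed
  have g': "(g has_real_derivative inverse ((Fw (x (g \<tau>)))\<^sup>2)) (at \<tau>)" if "\<tau> < T" for \<tau>
  proof (rule DERIV_inverse_function[OF f'])
    show "(Fw (x (g \<tau>)))\<^sup>2 \<noteq> 0" using nz by simp
    show "\<tau> - 1 < \<tau>" "\<tau> < T" using that by simp_all
    show "f (g y) = y" if "y < T" for y using fg[OF that] .
    have "isCont g (f (g \<tau>))"
      by (rule isCont_inverse_function[where d = 1 and f = f]) (use gf DERIV_isCont[OF f'] in auto)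
    then show "isCont g \<tau>" using fg[OF that] by simp
  qed
  define \<eta> where "\<eta> = (\<lambda>\<tau>. if \<tau> < T then x (g \<tau>) else 0)"
  have \<eta>': "(\<eta> has_vector_derivative Vw (\<eta> \<tau>)) (at \<tau>)" if "\<tau> < T" for \<tau>
  proof (rule has_vector_derivative_transform_within_open)
    have "(x \<circ> g has_vector_derivative inverse ((Fw (x (g \<tau>)))\<^sup>2) *\<^sub>R cal (x (g \<tau>))) (at \<tau>)"
      using vector_diff_chain_at[OF _ x] g'[OF that]
      by (simp add: has_real_derivative_iff_has_vector_derivative)
    then show "(x \<circ> g has_vector_derivative Vw (\<eta> \<tau>)) (at \<tau>)"
      using that by (simp add: \<eta>_def V_eq_calibration inverse_eq_divide)
    show "open {..<T}" "\<tau> \<in> {..<T}" using that by simp_all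
    show "(x \<circ> g) y = \<eta> y" if "y \<in> {..<T}" for y using that by (simp add: \<eta>_def)
  qed
  have rt\<eta>: "rt (\<eta> \<tau>) = rt p0 - sin \<beta> * \<tau>" if "\<tau> \<le> T" for \<tau>
  proof (cases "\<tau> < T")
    case True
    then have "(rt p0 - rt (x (g \<tau>))) / sin \<beta> = \<tau>" using fg by (simp add: f_def)
    then show ?thesis using True sin_beta_pos by (simp add: \<eta>_def field_simps)
  next
    case False
    then have "\<tau> = T" using that by simp
    then show ?thesis using sin_beta_pos by (simp add: \<eta>_def T_def)
  qed
  have cont: "continuous_on {0..T} \<eta>"
    unfolding continuous_on_eq_continuous_within
  proof
    fix \<tau> assume \<tau>: "\<tau> \<in> {0..T}"
    show "continuous (at \<tau> within {0..T}) \<eta>"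
    proof (cases "\<tau> < T")
      case True
      then show ?thesis
        using \<eta>' has_vector_derivative_continuous continuous_at_imp_continuous_at_within by blast
    next
      case False
      then have "\<tau> = T" using \<tau> by simp
      \<comment> \<open>At the final time the field is singular; continuity there comes from the known value of
        r_tilde along the curve.\<close>
      define b where "b = (\<lambda>t. sqrt (2 * (rt p0 - sin \<beta> * t) / min l1 l2))"
      have "(b \<longlongrightarrow> b T) (at T within {0..T})"
        unfolding b_def using l1_pos l2_pos by (intro tendsto_intros) auto
      moreover have "b T = 0" using sin_beta_pos by (simp add: b_def T_def)
      moreover have "norm (\<eta> t) \<le> b t" if "t \<in> {0..T}" for t
      proof -
        have "(norm (\<eta> t))\<^sup>2 \<le> 2 * (rt p0 - sin \<beta> * t) / min l1 l2"
          using norm_squared_le_r_tilde[of "\<eta> t"] rt\<eta>[of t] that l1_pos l2_pos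
          by (simp add: pos_le_divide_eq mult.commute)
        then show ?thesis unfolding b_def by (rule real_le_rsqrt)
      qed
      then have "\<forall>\<^sub>F t in at T within {0..T}. norm (\<eta> t) \<le> b t"
        by (auto simp: eventually_at_filter)
      ultimately have "(\<eta> \<longlongrightarrow> 0) (at T within {0..T})"
        using Lim_null_comparison by metis
      then show ?thesis by (simp add: \<open>\<tau> = T\<close> continuous_within \<eta>_def)
    qed
  qed
  have "f 0 = 0" by (simp add: f_def x0)
  then have "g 0 = 0" using gf[of 0] by simp
  then have "integral_curve_to_origin Vw p0 T \<eta>"
    unfolding integral_curve_to_origin_def
    using T cont \<eta>' nz x0 by (auto simp: \<eta>_def intro: has_vector_derivative_at_within)
  then show ?thesis using that by (simp add: T_def)
qed

end

section \<open>Uniqueness of the integral curve\<close>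

context calibrated_well
begin

lemma integral_curve_level:
  assumes "integral_curve_to_origin Vw p0 T \<eta>"
  shows "T = rt p0 / sin \<beta>" "\<And>t. t \<in> {0..T} \<Longrightarrow> rt (\<eta> t) = rt p0 - sin \<beta> * t"
proof -
  have \<eta>: "0 < T" "continuous_on {0..T} \<eta>" "\<eta> 0 = p0" "\<eta> T = 0"
    "\<And>t. t \<in> {0..<T} \<Longrightarrow> \<eta> t \<noteq> 0 \<and> (\<eta> has_vector_derivative Vw (\<eta> t)) (at t within {0..T})"
    using assms unfolding integral_curve_to_origin_def by blast+
  have "rt (\<eta> t) + sin \<beta> * t = rt (\<eta> 0) + sin \<beta> * 0" if "t \<in> {0..T}" for t
  proof (rule DERIV_isconst2[OF \<eta>(1)])
    show "continuous_on {0..T} (\<lambda>t. rt (\<eta> t) + sin \<beta> * t)"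
      unfolding r_tilde_def by (intro continuous_intros \<eta>(2))
    fix s assume s: "0 < s" "s < T"
    have "((\<lambda>t. rt (\<eta> t)) has_real_derivative - sin \<beta>) (at s within {0..T})"
      using r_tilde_has_derivative[of \<eta> "Vw (\<eta> s)" s "{0..T}"] \<eta>(5)[of s] s dr_tilde_V by auto
    then have "((\<lambda>t. rt (\<eta> t)) has_real_derivative - sin \<beta>) (at s)"
      using s by (simp add: at_within_Icc_at)
    then show "((\<lambda>t. rt (\<eta> t) + sin \<beta> * t) has_real_derivative 0) (at s)"
      by (auto intro!: derivative_eq_intros)
  qed (use that in auto)
  then have eq: "rt (\<eta> t) + sin \<beta> * t = rt p0" if "t \<in> {0..T}" for t
    using that \<eta>(3) by simp
  show "rt (\<eta> t) = rt p0 - sin \<beta> * t" if "t \<in> {0..T}" for t using eq[OF that] by simp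
  show "T = rt p0 / sin \<beta>" using eq[of T] \<eta>(1,4) sin_beta_pos by (simp add: field_simps)
qed

text \<open>
  A Gronwall argument: two curves that follow \<open>V\<close> with the same speed factor \<open>\<phi>'\<close> stay together as long
  as they keep away from the origin. The speed factor exists only almost everywhere, which
  is why the curves are assumed Lipschitz and the integrating factor involves \<open>\<phi>\<close> itself.
\<close>

lemma flow_unique_up_to_speed:
  assumes b: "0 \<le> b" and \<gamma>: "L-lipschitz_on {0..b} \<gamma>" and y: "M-lipschitz_on {0..b} y"
    and \<phi>: "K-lipschitz_on {0..b} \<phi>" and N: "negligible N"
    and \<gamma>': "\<And>t. t \<in> {0<..<b} - N \<Longrightarrow> (\<gamma> has_vector_derivative \<phi>' t *\<^sub>R Vw (\<gamma> t)) (at t)"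
    and y': "\<And>t. t \<in> {0<..<b} - N \<Longrightarrow> (y has_vector_derivative \<phi>' t *\<^sub>R Vw (y t)) (at t)"
    and \<phi>': "\<And>t. t \<in> {0<..<b} - N \<Longrightarrow> (\<phi> has_real_derivative \<phi>' t) (at t)"
    and \<phi>'_nonneg: "\<And>t. t \<in> {0<..<b} - N \<Longrightarrow> 0 \<le> \<phi>' t"
    and m: "0 < m" "\<And>t. t \<in> {0..b} \<Longrightarrow> m \<le> Fw (\<gamma> t)" "\<And>t. t \<in> {0..b} \<Longrightarrow> m \<le> Fw (y t)"
    and start: "\<gamma> 0 = y 0"
  shows "\<gamma> b = y b"
proof -
  \<comment> \<open>A Lipschitz constant of V on the set where F is at least m.\<close>
  define C where "C = (l1 + l2) / m\<^sup>2"
  define w where "w = (\<lambda>t. \<gamma> t - y t)"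
  define h where "h = (\<lambda>t. (w t \<bullet> w t) * exp (- 2 * C * \<phi> t))"
  have w: "(L + M)-lipschitz_on {0..b} w" unfolding w_def by (rule lipschitz_on_diff[OF \<gamma> y])
  have sq: "\<exists>A. A-lipschitz_on {0..b} (\<lambda>t. w t $ i * w t $ i)" for i
    by (rule lipschitz_on_mult_real[OF lipschitz_on_vec_nth[OF w] lipschitz_on_vec_nth[OF w]])
  obtain A1 where "A1-lipschitz_on {0..b} (\<lambda>t. w t $ 1 * w t $ 1)" using sq[of 1] by (elim exE)
  moreover obtain A2 where "A2-lipschitz_on {0..b} (\<lambda>t. w t $ 2 * w t $ 2)" using sq[of 2] by (elim exE)
  ultimately have 1: "(A1 + A2)-lipschitz_on {0..b} (\<lambda>t. w t \<bullet> w t)"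
    unfolding inner_vec_def sum_2 inner_real_def by (rule lipschitz_on_add)
  obtain E where 2: "E-lipschitz_on {0..b} (\<lambda>t. exp (- 2 * C * \<phi> t))"
    using lipschitz_on_exp[OF lipschitz_on_cmult_real[OF \<phi>]] by blast
  obtain H where H: "H-lipschitz_on {0..b} h"
    unfolding h_def using lipschitz_on_mult_real[OF 1 2] by blast
  have h': "(h has_real_derivative
      (2 * (w t \<bullet> (\<phi>' t *\<^sub>R (Vw (\<gamma> t) - Vw (y t)))) - 2 * C * \<phi>' t * (w t \<bullet> w t)) * exp (- 2 * C * \<phi> t)) (at t)"
    if t: "t \<in> {0<..<b} - N" for t
  proof -
    have wd: "(w has_vector_derivative \<phi>' t *\<^sub>R (Vw (\<gamma> t) - Vw (y t))) (at t)"
      unfolding w_def scaleR_right_diff_distrib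
      by (rule has_vector_derivative_diff[OF \<gamma>'[OF t] y'[OF t]])
    have "((\<lambda>t. w t \<bullet> w t) has_real_derivative 2 * (w t \<bullet> (\<phi>' t *\<^sub>R (Vw (\<gamma> t) - Vw (y t))))) (at t)"
      using bounded_bilinear.has_vector_derivative[OF bounded_bilinear_inner wd wd]
      by (simp add: has_real_derivative_iff_has_vector_derivative inner_commute)
    then show ?thesis
      unfolding h_def by (auto intro!: derivative_eq_intros \<phi>'[OF t] simp: algebra_simps)
  qed
  have "h b \<le> h 0"
  proof (rule lipschitz_nonincreasing[OF H b N h'])
    fix t assume t: "t \<in> {0<..<b} - N"
    then have tb: "t \<in> {0..b}" by auto
    have nz: "\<gamma> t \<noteq> 0" "y t \<noteq> 0" using m(2)[OF tb] m(3)[OF tb] m(1) by auto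
    have "norm (Vw (\<gamma> t) - Vw (y t)) \<le> ((l1 + l2) * norm (w t)) / (m * m)"
      unfolding V_distance[OF nz] w_def
      using F_le_norm m(1) m(2)[OF tb] m(3)[OF tb] l1_pos l2_pos by (intro frac_le mult_mono) auto
    also have "\<dots> = C * norm (w t)" by (simp add: C_def power2_eq_square)
    finally have "w t \<bullet> (Vw (\<gamma> t) - Vw (y t)) \<le> norm (w t) * (C * norm (w t))"
      by (meson norm_cauchy_schwarz order_trans mult_left_mono norm_ge_zero)
    also have "\<dots> = C * (w t \<bullet> w t)" by (simp add: dot_square_norm power2_eq_square)
    finally have "\<phi>' t * (w t \<bullet> (Vw (\<gamma> t) - Vw (y t))) \<le> \<phi>' t * (C * (w t \<bullet> w t))"
      using \<phi>'_nonneg[OF t] by (rule mult_left_mono)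
    then have "2 * (w t \<bullet> (\<phi>' t *\<^sub>R (Vw (\<gamma> t) - Vw (y t)))) - 2 * C * \<phi>' t * (w t \<bullet> w t) \<le> 0"
      by (simp add: algebra_simps)
    then show "(2 * (w t \<bullet> (\<phi>' t *\<^sub>R (Vw (\<gamma> t) - Vw (y t)))) - 2 * C * \<phi>' t * (w t \<bullet> w t)) * exp (- 2 * C * \<phi> t) \<le> 0"
      by (rule mult_nonpos_nonneg) simp
  qed
  also have "h 0 = 0" by (simp add: h_def w_def start)
  finally have "w b \<bullet> w b \<le> 0" by (simp add: h_def mult_le_0_iff)
  then have "w b = 0" by (meson inner_gt_zero_iff not_le)
  then show ?thesis by (simp add: w_def)
qed

text \<open>
  Before the final time \<open>r_tilde\<close> stays above a positive level, so \<open>F\<close> is bounded below and the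
  speed \<open>1 / F\<close> is bounded above.
\<close>

lemma integral_curve_away_from_origin:
  assumes "integral_curve_to_origin Vw p0 T \<eta>" "t < T"
  obtains m where "0 < m" "\<And>s. s \<in> {0..t} \<Longrightarrow> m \<le> Fw (\<eta> s)" "(1 / m)-lipschitz_on {0..t} \<eta>"
proof
  define m where "m = sqrt (2 * min l1 l2 * (rt p0 - sin \<beta> * t))"
  have T: "T = rt p0 / sin \<beta>" by (rule integral_curve_level(1)[OF assms(1)])
  have pos: "0 < rt p0 - sin \<beta> * t" using assms(2) sin_beta_pos by (simp add: T field_simps)
  then show "0 < m" using l1_pos l2_pos by (simp add: m_def)
  show mF: "m \<le> Fw (\<eta> s)" if "s \<in> {0..t}" for s
    unfolding m_def
    by (rule F_ge_on_superlevel)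
       (use integral_curve_level(2)[OF assms(1), of s] that assms(2) sin_beta_pos in simp)
  have d: "\<eta> s \<noteq> 0 \<and> (\<eta> has_vector_derivative Vw (\<eta> s)) (at s within {0..t})" if "s \<in> {0..t}" for s
    using assms that unfolding integral_curve_to_origin_def
    by (auto intro: has_vector_derivative_within_subset[where T = "{0..t}" and S = "{0..T}"])
  show "(1 / m)-lipschitz_on {0..t} \<eta>"
  proof (rule bounded_derivative_imp_lipschitz)
    fix s assume s: "s \<in> {0..t}"
    show "(\<eta> has_derivative (\<lambda>h. h *\<^sub>R Vw (\<eta> s))) (at s within {0..t})"
      using d[OF s] by (simp add: has_vector_derivative_def)
    have "norm (Vw (\<eta> s)) = 1 / Fw (\<eta> s)" by (rule norm_V)
    also have "\<dots> \<le> 1 / m" using mF[OF s] \<open>0 < m\<close> by (simp add: frac_le)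
    finally have "norm (h *\<^sub>R Vw (\<eta> s)) \<le> 1 / m * norm h" for h
      by (simp add: mult.commute[of "1 / m"] mult_left_mono del: times_divide_eq_left times_divide_eq_right)
    then show "onorm (\<lambda>h. h *\<^sub>R Vw (\<eta> s)) \<le> 1 / m"
      using \<open>0 < m\<close> by (intro onorm_bound) auto
  qed (use \<open>0 < m\<close> in auto)
qed

lemma integral_curve_unique:
  assumes "integral_curve_to_origin Vw p0 T \<eta>" "integral_curve_to_origin Vw p0 T' \<eta>'"
  shows "T' = T" "\<And>t. t \<in> {0..T} \<Longrightarrow> \<eta>' t = \<eta> t"
proof -
  show T: "T' = T" 
    using integral_curve_level(1)[OF assms(1)] integral_curve_level(1)[OF assms(2)] by simp
  fix t assume t: "t \<in> {0..T}"
  show "\<eta>' t = \<eta> t"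
  proof (cases "t < T")
    case False
    then show ?thesis using t assms T by (auto simp: integral_curve_to_origin_def)
  next
    case True
    obtain m where m: "0 < m" "\<And>s. s \<in> {0..t} \<Longrightarrow> m \<le> Fw (\<eta> s)" "(1 / m)-lipschitz_on {0..t} \<eta>"
      by (rule integral_curve_away_from_origin[OF assms(1) True]) (rule that)
    obtain m' where m': "0 < m'" "\<And>s. s \<in> {0..t} \<Longrightarrow> m' \<le> Fw (\<eta>' s)" "(1 / m')-lipschitz_on {0..t} \<eta>'"
      using integral_curve_away_from_origin[OF assms(2)] True T by metis
    have der: "(\<zeta> has_vector_derivative 1 *\<^sub>R Vw (\<zeta> s)) (at s)"
      if "integral_curve_to_origin Vw p0 T \<zeta>" "s \<in> {0<..<t} - {}" for \<zeta> s
      using that True unfolding integral_curve_to_origin_def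
      by (auto simp: at_within_Icc_at dest!: bspec[of _ _ s])
    show ?thesis
    proof (rule flow_unique_up_to_speed[where \<phi> = "\<lambda>s. s" and \<phi>' = "\<lambda>_. 1" and m = "min m m'" and N = "{}"])
      show "(1 / m')-lipschitz_on {0..t} \<eta>'" "(1 / m)-lipschitz_on {0..t} \<eta>" using m m' by blast+
      show "1-lipschitz_on {0..t} (\<lambda>s. s)" by (rule lipschitz_on_id)
      show "min m m' \<le> Fw (\<eta>' s)" "min m m' \<le> Fw (\<eta> s)" if "s \<in> {0..t}" for s
        using m(2)[OF that] m'(2)[OF that] by auto
      show "\<eta>' 0 = \<eta> 0" using assms by (simp add: integral_curve_to_origin_def)
    qed (use t m m' der[OF assms(1)] der[OF assms(2)[unfolded T]] in
          \<open>auto intro!: derivative_eq_intros\<close>)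
  qed
qed

end

section \<open>Line integrals along Lipschitz curves\<close>

abbreviation velocity :: "(real \<Rightarrow> 'a::real_normed_vector) \<Rightarrow> real \<Rightarrow> 'a" where
  "velocity \<gamma> t \<equiv> vector_derivative \<gamma> (at t)"

lemma locally_lipschitz_on_compact:
  assumes "locally_lipschitz_on X \<gamma>" "compact X"
  obtains L where "L-lipschitz_on X \<gamma>"
proof -
  \<comment> \<open>Local Lipschitz continuity of a family of functions, here with the single index 0.\<close>
  have "local_lipschitz {0::real} X (\<lambda>_. \<gamma>)"
    using assms(1) unfolding local_lipschitz_def locally_lipschitz_on_def by blast
  then show ?thesis
    using local_lipschitz_compact_implies_lipschitz[of "{0::real}" X "\<lambda>_. \<gamma>"] assms(2) that by auto
qed

lemma lipschitz_imp_locally_lipschitz_on: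
  assumes "L-lipschitz_on X \<gamma>" shows "locally_lipschitz_on X \<gamma>"
  unfolding locally_lipschitz_on_def
  using lipschitz_on_subset[OF assms Int_lower2] zero_less_one by blast

lemma absolutely_integrable_continuous_mult:
  fixes c h :: "real \<Rightarrow> real"
  assumes "continuous_on {a..b} c" "h absolutely_integrable_on {a..b}"
  shows "(\<lambda>t. c t * h t) absolutely_integrable_on {a..b}"
proof (rule absolutely_integrable_bounded_measurable_product_real[OF _ _ _ assms(2)])
  show "c \<in> borel_measurable (lebesgue_on {a..b})"
    by (rule continuous_imp_measurable_on_sets_lebesgue[OF assms(1)]) simp
  show "bounded (c ` {a..b})"
    by (intro compact_imp_bounded compact_continuous_image assms(1)) simp
qed simp

lemma nonneg_integral_eq_0_ae:
  fixes h :: "'a::euclidean_space \<Rightarrow> real"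
  assumes h: "h absolutely_integrable_on S" and nonneg: "\<And>t. 0 \<le> h t" and 0: "integral S h = 0"
  obtains N where "negligible N" "\<And>t. t \<in> S - N \<Longrightarrow> h t = 0"
proof -
  have "(\<integral>t. indicator S t *\<^sub>R h t \<partial>lebesgue) = 0"
    using set_lebesgue_integral_eq_integral(2)[OF h] 0 by (simp add: set_lebesgue_integral_def)
  moreover have "integrable lebesgue (\<lambda>t. indicator S t *\<^sub>R h t)"
    using h by (simp add: set_integrable_def)
  ultimately have "AE t in lebesgue. indicator S t *\<^sub>R h t = 0"
    using integral_nonneg_eq_0_iff_AE[of lebesgue "\<lambda>t. indicator S t *\<^sub>R h t"] nonneg by simp
  then obtain N where "N \<in> null_sets lebesgue" "{t. indicator S t *\<^sub>R h t \<noteq> 0} \<subseteq> N"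
    by (auto simp: eventually_ae_filter)
  then show ?thesis
    by (intro that[of N]) (auto simp: negligible_iff_null_sets indicator_def)
qed

lemma curve_to_origin_velocity:
  assumes "\<gamma> \<in> curves_to_origin p0"
  obtains L N where "L-lipschitz_on {0..1} \<gamma>" "negligible N"
    "\<And>t. t \<in> {0<..<1} - N \<Longrightarrow> (\<gamma> has_vector_derivative velocity \<gamma> t) (at t)"
    "velocity \<gamma> absolutely_integrable_on {0..1}"
proof -
  obtain L where L: "L-lipschitz_on {0..1} \<gamma>"
    by (rule locally_lipschitz_on_compact[of "{0..1}" \<gamma>])
       (use assms in \<open>auto simp: curves_to_origin_def\<close>)
  obtain N where "negligible N"
    "\<And>t. t \<in> {0<..<1} - N \<Longrightarrow> (\<gamma> has_vector_derivative velocity \<gamma> t) (at t)"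
    "velocity \<gamma> absolutely_integrable_on {0..1}"
    by (rule lipschitz_vector_derivative_ae[OF L]) (simp, rule that)
  with L show ?thesis by (rule that)
qed

lemma coordinate_form_integrable:
  fixes \<gamma> :: "real \<Rightarrow> real^'n::finite"
  assumes "L-lipschitz_on {a..b} \<gamma>" "velocity \<gamma> absolutely_integrable_on {a..b}"
  shows "(\<lambda>t. \<gamma> t $ i * velocity \<gamma> t $ j) absolutely_integrable_on {a..b}"
proof (rule absolutely_integrable_continuous_mult)
  show "continuous_on {a..b} (\<lambda>t. \<gamma> t $ i)"
    by (intro continuous_intros lipschitz_on_continuous_on[OF assms(1)])
  show "(\<lambda>t. velocity \<gamma> t $ j) absolutely_integrable_on {a..b}"
    using absolutely_integrable_component[OF assms(2), of "axis j 1"] by (simp add: inner_axis)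
qed

text \<open>
  \<open>omega0 - omega1\<close> is exact, namely \<open>- l1 / (l1 + l2) d(p1 p2)\<close>, so its integral depends on the starting
  point alone.
\<close>

lemma omega_difference_integral:
  assumes "\<gamma> \<in> curves_to_origin p0" "0 < l1" "0 < l2"
  shows "line_integral (\<lambda>p v. omega0 p v - omega1 l1 l2 p v) \<gamma> = l1 / (l1 + l2) * (p0$1 * p0$2)"
proof -
  obtain L N where L: "L-lipschitz_on {0..1} \<gamma>" and N: "negligible N"
    and vel: "\<And>t. t \<in> {0<..<1} - N \<Longrightarrow> (\<gamma> has_vector_derivative velocity \<gamma> t) (at t)"
    by (rule curve_to_origin_velocity[OF assms(1)]) (rule that)
  define h where "h = (\<lambda>t. \<gamma> t $ 1 * \<gamma> t $ 2)"
  obtain K where K: "K-lipschitz_on {0..1} h"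
    unfolding h_def using lipschitz_on_mult_real[OF lipschitz_on_vec_nth[OF L] lipschitz_on_vec_nth[OF L]] by blast
  have "((\<lambda>t. \<gamma> t $ 1 * velocity \<gamma> t $ 2 + velocity \<gamma> t $ 1 * \<gamma> t $ 2) has_integral h 1 - h 0) {0..1}"
  proof (rule lipschitz_has_integral_derivative(1)[OF K _ N])
    show "(h has_real_derivative \<gamma> t $ 1 * velocity \<gamma> t $ 2 + velocity \<gamma> t $ 1 * \<gamma> t $ 2) (at t)"
      if "t \<in> {0<..<1} - N" for t
      unfolding h_def
      using DERIV_mult'[OF has_real_derivative_vec_nth[OF vel[OF that]] has_real_derivative_vec_nth[OF vel[OF that]]]
      by simp
  qed simp
  then have "((\<lambda>t. - (l1 / (l1 + l2)) * (\<gamma> t $ 1 * velocity \<gamma> t $ 2 + velocity \<gamma> t $ 1 * \<gamma> t $ 2))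
      has_integral - (l1 / (l1 + l2)) * (h 1 - h 0)) {0..1}"
    by (rule has_integral_mult_right)
  moreover have "- (l1 / (l1 + l2)) * (p$1 * v$2 + v$1 * p$2) = omega0 p v - omega1 l1 l2 p v" for p v
    using assms(2,3) by (simp add: omega0_def omega1_def field_simps)
  ultimately have "((\<lambda>t. omega0 (\<gamma> t) (velocity \<gamma> t) - omega1 l1 l2 (\<gamma> t) (velocity \<gamma> t))
      has_integral - (l1 / (l1 + l2)) * (h 1 - h 0)) {0..1}" by simp
  then show ?thesis
    using assms(1) by (simp add: line_integral_def integral_unique h_def curves_to_origin_def)
qed

lemma omega1_integrable:
  assumes "\<gamma> \<in> curves_to_origin p0"
  shows "(\<lambda>t. omega1 l1 l2 (\<gamma> t) (velocity \<gamma> t)) absolutely_integrable_on {0..1}"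
proof -
  obtain L where L: "L-lipschitz_on {0..1} \<gamma>" and vel: "velocity \<gamma> absolutely_integrable_on {0..1}"
    by (rule curve_to_origin_velocity[OF assms]) (rule that)
  have "(\<lambda>t. (- l2 / (l1 + l2)) * (\<gamma> t $ 2 * velocity \<gamma> t $ 1) + (l1 / (l1 + l2)) * (\<gamma> t $ 1 * velocity \<gamma> t $ 2))
      absolutely_integrable_on {0..1}"
    by (intro set_integral_add(1) set_integrable_mult_right coordinate_form_integrable[OF L vel])
  then show ?thesis by (simp add: omega1_def mult.assoc diff_divide_distrib)
qed

lemma area_eq_line_integral:
  assumes "\<gamma> \<in> curves_to_origin p0" "0 < l1" "0 < l2"
  shows "area \<gamma> = line_integral (omega1 l1 l2) \<gamma> + l1 / (l1 + l2) * (p0$1 * p0$2)"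
proof -
  obtain L where L: "L-lipschitz_on {0..1} \<gamma>" and vel: "velocity \<gamma> absolutely_integrable_on {0..1}"
    by (rule curve_to_origin_velocity[OF assms(1)]) (rule that)
  have "(\<lambda>t. \<gamma> t $ 2 * velocity \<gamma> t $ 1) integrable_on {0..1}"
    using coordinate_form_integrable[OF L vel] set_lebesgue_integral_eq_integral(1) by blast
  then have "(\<lambda>t. omega0 (\<gamma> t) (velocity \<gamma> t)) integrable_on {0..1}"
    by (simp add: omega0_def integrable_neg_iff)
  moreover have "(\<lambda>t. omega1 l1 l2 (\<gamma> t) (velocity \<gamma> t)) integrable_on {0..1}"
    using omega1_integrable[OF assms(1)] set_lebesgue_integral_eq_integral(1) by blast
  ultimately have "line_integral (\<lambda>p v. omega0 p v - omega1 l1 l2 p v) \<gamma> =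
      line_integral omega0 \<gamma> - line_integral (omega1 l1 l2) \<gamma>"
    unfolding line_integral_def by (rule integral_diff)
  moreover have "area \<gamma> = line_integral omega0 \<gamma>"
    by (simp add: area_def line_integral_def omega0_def)
  ultimately show ?thesis using omega_difference_integral[OF assms] by simp
qed

context quadratic_well
begin

lemma r_tilde_lipschitz:
  fixes \<gamma> :: "real \<Rightarrow> real^2"
  assumes "L-lipschitz_on {a..b} \<gamma>"
  shows "\<exists>K. K-lipschitz_on {a..b} (\<lambda>t. rt (\<gamma> t))"
proof -
  have "\<exists>A. A-lipschitz_on {a..b} (\<lambda>t. \<gamma> t $ i * \<gamma> t $ i)" for i
    by (rule lipschitz_on_mult_real[OF lipschitz_on_vec_nth[OF assms] lipschitz_on_vec_nth[OF assms]])
  then obtain A B where A: "A-lipschitz_on {a..b} (\<lambda>t. \<gamma> t $ 1 * \<gamma> t $ 1)"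
    and B: "B-lipschitz_on {a..b} (\<lambda>t. \<gamma> t $ 2 * \<gamma> t $ 2)" by meson
  have "\<exists>K. K-lipschitz_on {a..b} (\<lambda>t. (1/2) * (l1 * (\<gamma> t $ 1 * \<gamma> t $ 1) + l2 * (\<gamma> t $ 2 * \<gamma> t $ 2)))"
    by (rule exI) (rule lipschitz_on_cmult_real lipschitz_on_add A B)+
  then show ?thesis by (simp add: r_tilde_def power2_eq_square)
qed

lemma dr_tilde_integral:
  assumes "\<gamma> \<in> curves_to_origin p0"
  shows "((\<lambda>t. dr_tilde l1 l2 (\<gamma> t) (velocity \<gamma> t)) has_integral - rt p0) {0..1}"
    and "(\<lambda>t. dr_tilde l1 l2 (\<gamma> t) (velocity \<gamma> t)) absolutely_integrable_on {0..1}"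
proof -
  obtain L N where L: "L-lipschitz_on {0..1} \<gamma>" and N: "negligible N"
    and vel: "\<And>t. t \<in> {0<..<1} - N \<Longrightarrow> (\<gamma> has_vector_derivative velocity \<gamma> t) (at t)"
    by (rule curve_to_origin_velocity[OF assms]) (rule that)
  obtain K where K: "K-lipschitz_on {0..1} (\<lambda>t. rt (\<gamma> t))" using r_tilde_lipschitz[OF L] by blast
  note * = lipschitz_has_integral_derivative[OF K zero_le_one N r_tilde_has_derivative[OF vel]]
  show "((\<lambda>t. dr_tilde l1 l2 (\<gamma> t) (velocity \<gamma> t)) has_integral - rt p0) {0..1}"
    using *(1) assms by (simp add: curves_to_origin_def)
  show "(\<lambda>t. dr_tilde l1 l2 (\<gamma> t) (velocity \<gamma> t)) absolutely_integrable_on {0..1}"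
    using *(2) .
qed

end

section \<open>The calibration bound and its equality case\<close>

context calibrated_well
begin

text \<open>
  The velocity realises equality in the calibration inequality almost everywhere. At the origin both
  sides vanish, so a curve that has arrived there stays calibrated.
\<close>

definition calibrated :: "(real \<Rightarrow> real^2) \<Rightarrow> bool" where
  "calibrated \<gamma> \<longleftrightarrow> (\<exists>N. negligible N \<and>
     (\<forall>t\<in>{0<..<1} - N. cal (\<gamma> t) \<bullet> velocity \<gamma> t = Fw (\<gamma> t) * norm (velocity \<gamma> t)))"

lemma energy_integrable:
  assumes "\<gamma> \<in> curves_to_origin p0"
  shows "(\<lambda>t. Fw (\<gamma> t) * norm (velocity \<gamma> t)) absolutely_integrable_on {0..1}"
proof -
  obtain L where L: "L-lipschitz_on {0..1} \<gamma>" and vel: "velocity \<gamma> absolutely_integrable_on {0..1}"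
    by (rule curve_to_origin_velocity[OF assms]) (rule that)
  show ?thesis
  proof (rule absolutely_integrable_continuous_mult)
    show "continuous_on {0..1} (\<lambda>t. Fw (\<gamma> t))"
      by (rule continuous_on_compose2[OF continuous_on_F[of UNIV] lipschitz_on_continuous_on[OF L]]) simp
    show "(\<lambda>t. norm (velocity \<gamma> t)) absolutely_integrable_on {0..1}"
      using absolutely_integrable_norm[OF vel] by (simp add: o_def)
  qed
qed

lemma calibration_integral:
  assumes "\<gamma> \<in> curves_to_origin p0"
  shows "((\<lambda>t. cal (\<gamma> t) \<bullet> velocity \<gamma> t) has_integral
      (l1 + l2) * cos \<beta> * line_integral (omega1 l1 l2) \<gamma> + sin \<beta> * rt p0) {0..1}"
    and "(\<lambda>t. cal (\<gamma> t) \<bullet> velocity \<gamma> t) absolutely_integrable_on {0..1}"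
proof -
  note \<omega> = omega1_integrable[OF assms, of l1 l2]
  have "((\<lambda>t. omega1 l1 l2 (\<gamma> t) (velocity \<gamma> t)) has_integral line_integral (omega1 l1 l2) \<gamma>) {0..1}"
    unfolding line_integral_def
    by (rule integrable_integral[OF set_lebesgue_integral_eq_integral(1)[OF \<omega>]])
  from has_integral_diff[OF has_integral_mult_right[OF this, of "(l1 + l2) * cos \<beta>"]
      has_integral_mult_right[OF dr_tilde_integral(1)[OF assms], of "sin \<beta>"]]
  show "((\<lambda>t. cal (\<gamma> t) \<bullet> velocity \<gamma> t) has_integral
      (l1 + l2) * cos \<beta> * line_integral (omega1 l1 l2) \<gamma> + sin \<beta> * rt p0) {0..1}"
    unfolding calibration_inner by simp
  show "(\<lambda>t. cal (\<gamma> t) \<bullet> velocity \<gamma> t) absolutely_integrable_on {0..1}"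
    unfolding calibration_inner using \<omega> dr_tilde_integral(2)[OF assms]
    by (intro set_integral_diff(1) set_integrable_mult_right)
qed

text \<open>
  The calibration inequality. The defect \<open>F |\<gamma>'| - calibration \<bullet> \<gamma>'\<close> is nonnegative, so its integral
  vanishes exactly if it vanishes almost everywhere.
\<close>

theorem energy_lower_bound:
  assumes "\<gamma> \<in> curves_to_origin p0"
  shows "(l1 + l2) * cos \<beta> * line_integral (omega1 l1 l2) \<gamma> + sin \<beta> * rt p0 \<le> energy l1 l2 \<gamma>"
    and "energy l1 l2 \<gamma> = (l1 + l2) * cos \<beta> * line_integral (omega1 l1 l2) \<gamma> + sin \<beta> * rt p0
      \<longleftrightarrow> calibrated \<gamma>"
proof -
  define h where "h = (\<lambda>t. Fw (\<gamma> t) * norm (velocity \<gamma> t) - cal (\<gamma> t) \<bullet> velocity \<gamma> t)"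
  define c where "c = (l1 + l2) * cos \<beta> * line_integral (omega1 l1 l2) \<gamma> + sin \<beta> * rt p0"
  have h0: "0 \<le> h t" for t using calibration_le by (simp add: h_def)
  have hint: "h absolutely_integrable_on {0..1}"
    unfolding h_def by (rule set_integral_diff(1)[OF energy_integrable[OF assms] calibration_integral(2)[OF assms]])
  have "((\<lambda>t. Fw (\<gamma> t) * norm (velocity \<gamma> t)) has_integral energy l1 l2 \<gamma>) {0..1}"
    unfolding energy_def
    by (rule integrable_integral[OF set_lebesgue_integral_eq_integral(1)[OF energy_integrable[OF assms]]])
  then have h: "(h has_integral energy l1 l2 \<gamma> - c) {0..1}"
    unfolding h_def c_def by (rule has_integral_diff[OF _ calibration_integral(1)[OF assms]])
  have "0 \<le> energy l1 l2 \<gamma> - c" by (rule has_integral_nonneg[OF h]) (rule h0)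
  then show "(l1 + l2) * cos \<beta> * line_integral (omega1 l1 l2) \<gamma> + sin \<beta> * rt p0 \<le> energy l1 l2 \<gamma>"
    by (simp add: c_def)
  have "energy l1 l2 \<gamma> = c \<longleftrightarrow> calibrated \<gamma>"
  proof
    assume "energy l1 l2 \<gamma> = c"
    then have "integral {0..1} h = 0" using h by (simp add: integral_unique)
    then obtain N where N: "negligible N" "\<And>t. t \<in> {0..1} - N \<Longrightarrow> h t = 0"
      by (rule nonneg_integral_eq_0_ae[OF hint h0]) (rule that)
    have "cal (\<gamma> t) \<bullet> velocity \<gamma> t = Fw (\<gamma> t) * norm (velocity \<gamma> t)" if "t \<in> {0<..<1} - N" for t
      using N(2)[of t] that by (simp add: h_def)
    with N(1) show "calibrated \<gamma>" unfolding calibrated_def by blast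
  next
    assume "calibrated \<gamma>"
    then obtain N where N: "negligible N"
      "\<And>t. t \<in> {0<..<1} - N \<Longrightarrow> cal (\<gamma> t) \<bullet> velocity \<gamma> t = Fw (\<gamma> t) * norm (velocity \<gamma> t)"
      unfolding calibrated_def by blast
    have "(h has_integral 0) {0..1}"
    proof (rule has_integral_spike[OF _ _ has_integral_0])
      show "negligible (insert 0 (insert 1 N))" using N(1) by simp
      show "h t = 0" if "t \<in> {0..1} - insert 0 (insert 1 N)" for t
        using N(2)[of t] that by (simp add: h_def)
    qed
    then have "energy l1 l2 \<gamma> - c = 0" by (rule has_integral_unique[OF h])
    then show "energy l1 l2 \<gamma> = c" by simp
  qed
  then show "energy l1 l2 \<gamma> = (l1 + l2) * cos \<beta> * line_integral (omega1 l1 l2) \<gamma> + sin \<beta> * rt p0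
      \<longleftrightarrow> calibrated \<gamma>" by (simp add: c_def)
qed

text \<open>
  Away from the origin, the rate at which \<open>r_tilde\<close> decreases determines a calibrated velocity. The relation between \<open>omega1\<close> and \<open>dr_tilde\<close> persists at the origin, where both vanish.
\<close>

lemma calibrated_velocity:
  assumes "cal p \<bullet> v = Fw p * norm v"
  shows "dr_tilde l1 l2 p v \<le> 0" "p \<noteq> 0 \<Longrightarrow> v = (- dr_tilde l1 l2 p v / sin \<beta>) *\<^sub>R Vw p"
    "omega1 l1 l2 p v = - cos \<beta> / (sin \<beta> * (l1 + l2)) * dr_tilde l1 l2 p v"
proof -
  show 1: "p \<noteq> 0 \<Longrightarrow> v = (- dr_tilde l1 l2 p v / sin \<beta>) *\<^sub>R Vw p"
    using calibration_eq_imp(1) assms by blast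
  show "dr_tilde l1 l2 p v \<le> 0"
    using calibration_eq_imp(2)[OF _ assms] by (cases "p = 0") (auto simp: dr_tilde_def)
  show "omega1 l1 l2 p v = - cos \<beta> / (sin \<beta> * (l1 + l2)) * dr_tilde l1 l2 p v"
  proof (cases "p = 0")
    case False
    have "omega1 l1 l2 p (k *\<^sub>R w) = k * omega1 l1 l2 p w" for k w
      by (simp add: omega1_def algebra_simps)
    then have "omega1 l1 l2 p v = (- dr_tilde l1 l2 p v / sin \<beta>) * (cos \<beta> / (l1 + l2))"
      using 1[OF False] omega1_V[OF False] by metis
    then show ?thesis by (simp add: mult.commute)
  qed (simp add: omega1_def dr_tilde_def)
qed

lemma calibrated_line_integral:
  assumes \<gamma>: "\<gamma> \<in> curves_to_origin p0" and cal: "calibrated \<gamma>"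
  shows "line_integral (omega1 l1 l2) \<gamma> = rt p0 / (l1 + l2) * cot \<beta>"
proof -
  obtain N where N: "negligible N"
    "\<And>t. t \<in> {0<..<1} - N \<Longrightarrow> cal (\<gamma> t) \<bullet> velocity \<gamma> t = Fw (\<gamma> t) * norm (velocity \<gamma> t)"
    using cal unfolding calibrated_def by blast
  have "((\<lambda>t. omega1 l1 l2 (\<gamma> t) (velocity \<gamma> t)) has_integral
      (- cos \<beta> / (sin \<beta> * (l1 + l2))) * - rt p0) {0..1}"
  proof (rule has_integral_spike[OF _ _ has_integral_mult_right[OF dr_tilde_integral(1)[OF \<gamma>]]])
    show "negligible (insert 0 (insert 1 N))" using N(1) by simp
    show "omega1 l1 l2 (\<gamma> t) (velocity \<gamma> t) =
        (- cos \<beta> / (sin \<beta> * (l1 + l2))) * dr_tilde l1 l2 (\<gamma> t) (velocity \<gamma> t)"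
      if "t \<in> {0..1} - insert 0 (insert 1 N)" for t
      using calibrated_velocity(3)[OF N(2)[of t]] that by simp
  qed
  then show ?thesis by (simp add: line_integral_def integral_unique cot_def ac_simps)
qed

text \<open>
  The change of parameter is assumed to be merely continuous and monotone, but it can be recovered
  from the level of \<open>r_tilde\<close>: \<open>\<phi> = (r_tilde p0 - r_tilde \<circ> \<gamma>) / sin \<beta>\<close>. Hence it is differentiable wherever
  \<open>\<gamma>\<close> is, and the chain rule shows that the velocity is \<open>\<phi>' V\<close>.
\<close>

lemma reparametrization_imp_calibrated:
  assumes \<gamma>: "\<gamma> \<in> curves_to_origin p0" and \<eta>: "integral_curve_to_origin Vw p0 T \<eta>"
    and "reparametrization_of T \<eta> \<gamma>"
  shows "calibrated \<gamma>"
proof -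
  obtain \<phi> where \<phi>: "mono_on {0..1} \<phi>" "\<phi> ` {0..1} = {0..T}" "\<And>t. t \<in> {0..1} \<Longrightarrow> \<gamma> t = \<eta> (\<phi> t)"
    using assms(3) unfolding reparametrization_of_def by blast
  obtain N where N: "negligible N"
    "\<And>t. t \<in> {0<..<1} - N \<Longrightarrow> (\<gamma> has_vector_derivative velocity \<gamma> t) (at t)"
    by (rule curve_to_origin_velocity[OF \<gamma>]) (rule that)
  have \<phi>_eq: "\<phi> t = (rt p0 - rt (\<gamma> t)) / sin \<beta>" if "t \<in> {0..1}" for t
  proof -
    have "\<phi> t \<in> {0..T}" using that \<phi>(2) by blast
    then have "rt (\<gamma> t) = rt p0 - sin \<beta> * \<phi> t"
      using integral_curve_level(2)[OF \<eta>] \<phi>(3)[OF that] by simp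
    then show ?thesis using sin_beta_pos by simp
  qed
  have "cal (\<gamma> t) \<bullet> velocity \<gamma> t = Fw (\<gamma> t) * norm (velocity \<gamma> t)" if t: "t \<in> {0<..<1} - N" for t
  proof (cases "\<gamma> t = 0")
    case True
    then show ?thesis using norm_calibration[of 0] by simp
  next
    case False
    define k where "k = - dr_tilde l1 l2 (\<gamma> t) (velocity \<gamma> t) / sin \<beta>"
    have "((\<lambda>t. (rt p0 - rt (\<gamma> t)) / sin \<beta>) has_real_derivative k) (at t)"
      unfolding k_def using sin_beta_pos
      by (auto intro!: derivative_eq_intros r_tilde_has_derivative[OF N(2)[OF t]])
    then have d\<phi>: "(\<phi> has_real_derivative k) (at t)"
      by (rule has_field_derivative_transform_within_open[where S = "{0<..<1}"])
         (use t \<phi>_eq in auto)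
    have k: "0 \<le> k"
      by (rule mono_on_imp_deriv_nonneg[OF \<phi>(1) d\<phi>]) (use t in \<open>auto simp: interior_cbox\<close>)
    have \<phi>t: "\<phi> t \<in> {0..<T}"
    proof -
      have "\<phi> t \<in> {0..T}" using \<phi>(2) t by auto
      moreover have "\<phi> t \<noteq> T" using False \<phi>(3)[of t] t \<eta> by (auto simp: integral_curve_to_origin_def)
      ultimately show ?thesis by auto
    qed
    have "(\<eta> has_vector_derivative Vw (\<eta> (\<phi> t))) (at (\<phi> t) within {0..T})"
      using \<eta> \<phi>t unfolding integral_curve_to_origin_def by blast
    then have "(\<eta> has_vector_derivative Vw (\<eta> (\<phi> t))) (at (\<phi> t) within \<phi> ` {0<..<1})"
      by (rule has_vector_derivative_within_subset) (use \<phi>(2) in force)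
    then have "((\<eta> \<circ> \<phi>) has_vector_derivative k *\<^sub>R Vw (\<eta> (\<phi> t))) (at t within {0<..<1})"
      using d\<phi> by (intro vector_diff_chain_within)
        (auto simp: has_real_derivative_iff_has_vector_derivative intro: has_vector_derivative_at_within)
    then have "((\<eta> \<circ> \<phi>) has_vector_derivative k *\<^sub>R Vw (\<gamma> t)) (at t)"
      using t \<phi>(3)[of t] by (simp add: at_within_open[of t "{0<..<1}"])
    then have "(\<gamma> has_vector_derivative k *\<^sub>R Vw (\<gamma> t)) (at t)"
      by (rule has_vector_derivative_transform_within_open[where S = "{0<..<1}"]) (use t \<phi>(3) in auto)
    then have v: "velocity \<gamma> t = k *\<^sub>R Vw (\<gamma> t)" by (rule vector_derivative_at)
    have "cal (\<gamma> t) = (Fw (\<gamma> t))\<^sup>2 *\<^sub>R Vw (\<gamma> t)"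
      using False by (simp add: V_eq_calibration)
    then show ?thesis
      using k False by (simp add: v dot_square_norm norm_V power_divide)
  qed
  with N(1) show ?thesis unfolding calibrated_def by blast
qed

text \<open>
  The parameter change must be \<open>\<phi> = (r_tilde p0 - r_tilde \<circ> \<gamma>) / sin \<beta>\<close>. It is Lipschitz with a
  nonnegative derivative almost everywhere, and both \<open>\<gamma>\<close> and \<open>\<eta> \<circ> \<phi>\<close> follow \<open>V\<close> with speed factor \<open>\<phi>'\<close>,
  so they coincide until they reach the origin. After that \<open>r_tilde\<close>, being nonincreasing along \<open>\<gamma>\<close>,
  keeps \<open>\<gamma>\<close> at the origin.
\<close>

lemma calibrated_imp_reparametrization:
  assumes \<gamma>: "\<gamma> \<in> curves_to_origin p0" and \<eta>: "integral_curve_to_origin Vw p0 T \<eta>"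
    and "calibrated \<gamma>"
  shows "reparametrization_of T \<eta> \<gamma>"
proof -
  obtain L N1 where L: "L-lipschitz_on {0..1} \<gamma>" and N1: "negligible N1"
    and vel: "\<And>t. t \<in> {0<..<1} - N1 \<Longrightarrow> (\<gamma> has_vector_derivative velocity \<gamma> t) (at t)"
    by (rule curve_to_origin_velocity[OF \<gamma>]) (rule that)
  obtain N2 where N2: "negligible N2"
    "\<And>t. t \<in> {0<..<1} - N2 \<Longrightarrow> cal (\<gamma> t) \<bullet> velocity \<gamma> t = Fw (\<gamma> t) * norm (velocity \<gamma> t)"
    using assms(3) unfolding calibrated_def by blast
  define N where "N = N1 \<union> N2"
  have N: "negligible N" using N1 N2 by (simp add: N_def)
  have ends: "\<gamma> 0 = p0" "\<gamma> 1 = 0" using \<gamma> by (auto simp: curves_to_origin_def)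
  have T: "T = rt p0 / sin \<beta>" by (rule integral_curve_level(1)[OF \<eta>])
  define \<phi> where "\<phi> = (\<lambda>t. (rt p0 - rt (\<gamma> t)) / sin \<beta>)"
  define \<phi>' where "\<phi>' = (\<lambda>t. - dr_tilde l1 l2 (\<gamma> t) (velocity \<gamma> t) / sin \<beta>)"
  have d\<phi>: "(\<phi> has_real_derivative \<phi>' t) (at t)" if "t \<in> {0<..<1} - N" for t
    unfolding \<phi>_def \<phi>'_def using sin_beta_pos that
    by (auto intro!: derivative_eq_intros r_tilde_has_derivative[OF vel] simp: N_def)
  have \<phi>'_nonneg: "0 \<le> \<phi>' t" if "t \<in> {0<..<1} - N" for t
    using calibrated_velocity(1)[OF N2(2)[of t]] that sin_beta_pos
    by (simp add: \<phi>'_def N_def divide_nonpos_pos)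
  obtain K0 where "K0-lipschitz_on {0..1} (\<lambda>t. rt (\<gamma> t))" using r_tilde_lipschitz[OF L] by blast
  then have "(\<bar>1 / sin \<beta>\<bar> * (0 + K0))-lipschitz_on {0..1} (\<lambda>t. (1 / sin \<beta>) * (rt p0 - rt (\<gamma> t)))"
    by (intro lipschitz_on_cmult_real lipschitz_on_diff lipschitz_on_constant)
  then obtain K where K: "K-lipschitz_on {0..1} \<phi>" unfolding \<phi>_def by (simp add: field_simps)
  have mono: "\<phi> s \<le> \<phi> t" if st: "0 \<le> s" "s \<le> t" "t \<le> 1" for s t
  proof -
    have "- \<phi> t \<le> - \<phi> s"
    proof (rule lipschitz_nonincreasing[where f = "\<lambda>t. - \<phi> t" and f' = "\<lambda>t. - \<phi>' t" and N = N])
      show "K-lipschitz_on {s..t} (\<lambda>t. - \<phi> t)"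
        using lipschitz_on_subset[OF K] st by simp
      show "((\<lambda>t. - \<phi> t) has_real_derivative - \<phi>' u) (at u)" if "u \<in> {s<..<t} - N" for u
        using that st by (intro DERIV_minus d\<phi>) auto
      show "- \<phi>' u \<le> 0" if "u \<in> {s<..<t} - N" for u
        using that st \<phi>'_nonneg[of u] by auto
    qed (use st N in auto)
    then show ?thesis by simp
  qed
  have \<phi>01: "\<phi> 0 = 0" "\<phi> 1 = T" by (simp_all add: \<phi>_def ends T)
  have cont: "continuous_on {0..1} \<phi>" by (rule lipschitz_on_continuous_on[OF K])
  have range: "\<phi> t \<in> {0..T}" if "t \<in> {0..1}" for t
    using mono[of 0 t] mono[of t 1] that \<phi>01 by auto
  have level: "rt (\<gamma> t) = rt p0 - sin \<beta> * \<phi> t" for t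
    using sin_beta_pos by (simp add: \<phi>_def)
  have eq: "\<gamma> t = \<eta> (\<phi> t)" if t: "t \<in> {0..1}" for t
  proof (cases "\<phi> t < T")
    case False
    then have "\<phi> t = T" using range[OF t] by simp
    moreover from this have "rt (\<gamma> t) = 0" using sin_beta_pos level[of t] by (simp add: T)
    ultimately show ?thesis using \<eta> by (simp add: integral_curve_to_origin_def)
  next
    case True
    \<comment> \<open>Uniqueness is applied on [0, t], where neither curve has come closer to the origin than
      at time t.\<close>
    have sub: "\<phi> s \<in> {0..\<phi> t}" if "s \<in> {0..t}" for s
      using mono[of 0 s] mono[of s t] that t \<phi>01 by auto
    obtain m where m: "0 < m" "\<And>s. s \<in> {0..\<phi> t} \<Longrightarrow> m \<le> Fw (\<eta> s)" "(1 / m)-lipschitz_on {0..\<phi> t} \<eta>"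
      by (rule integral_curve_away_from_origin[OF \<eta> True]) (rule that)
    define m2 where "m2 = sqrt (2 * min l1 l2 * (rt p0 - sin \<beta> * \<phi> t))"
    have pos: "0 < rt p0 - sin \<beta> * \<phi> t" using True sin_beta_pos by (simp add: T field_simps)
    then have m2: "0 < m2" using l1_pos l2_pos by (simp add: m2_def)
    have m2F: "m2 \<le> Fw (\<gamma> s)" if s: "s \<in> {0..t}" for s
      unfolding m2_def
      by (rule F_ge_on_superlevel) (use level[of s] sub[OF s] sin_beta_pos in simp)
    have sub01: "{0..t} \<subseteq> {0..1}" using t by auto
    have lips: "L-lipschitz_on {0..t} \<gamma>" "K-lipschitz_on {0..t} \<phi>"
      using lipschitz_on_subset[OF L sub01] lipschitz_on_subset[OF K sub01] by blast+
    define y where "y = \<eta> \<circ> \<phi>"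
    have y: "(1 / m * K)-lipschitz_on {0..t} y"
      unfolding y_def
      by (rule lipschitz_on_compose[OF lips(2) lipschitz_on_subset[OF m(3)]]) (use sub in auto)
    have "\<gamma> t = y t"
    proof (rule flow_unique_up_to_speed[OF _ lips(1) y lips(2) N, where \<phi>' = \<phi>' and m = "min m m2"])
      show "0 \<le> t" using t by simp
      fix s assume s: "s \<in> {0<..<t} - N"
      then have s01: "s \<in> {0<..<1} - N" using t by auto
      show "(\<phi> has_real_derivative \<phi>' s) (at s)" "0 \<le> \<phi>' s" using d\<phi>[OF s01] \<phi>'_nonneg[OF s01] by blast+
      have "\<gamma> s \<noteq> 0" using m2F[of s] m2 s by force
      then have "velocity \<gamma> s = \<phi>' s *\<^sub>R Vw (\<gamma> s)"
        unfolding \<phi>'_def using calibrated_velocity(2)[OF N2(2)] s01 by (simp add: N_def)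
      then show "(\<gamma> has_vector_derivative \<phi>' s *\<^sub>R Vw (\<gamma> s)) (at s)"
        using vel[of s] s01 by (simp add: N_def)
      have "(\<eta> has_vector_derivative Vw (\<eta> (\<phi> s))) (at (\<phi> s) within {0..T})"
        using \<eta> sub[of s] s True unfolding integral_curve_to_origin_def by auto
      then have "(\<eta> has_vector_derivative Vw (\<eta> (\<phi> s))) (at (\<phi> s) within \<phi> ` {0<..<1})"
        by (rule has_vector_derivative_within_subset) (use range in force)
      then have "(y has_vector_derivative \<phi>' s *\<^sub>R Vw (\<eta> (\<phi> s))) (at s within {0<..<1})"
        unfolding y_def using d\<phi>[OF s01] by (intro vector_diff_chain_within)
          (auto simp: has_real_derivative_iff_has_vector_derivative intro: has_vector_derivative_at_within)
      then show "(y has_vector_derivative \<phi>' s *\<^sub>R Vw (y s)) (at s)"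
        using s01 by (simp add: y_def at_within_open[of s "{0<..<1}"])
    next
      show "\<gamma> 0 = y 0" using \<eta> by (simp add: y_def ends \<phi>01 integral_curve_to_origin_def)
      show "0 < min m m2" using m m2 by simp
      fix s assume s: "s \<in> {0..t}"
      show "min m m2 \<le> Fw (\<gamma> s)" using m2F[OF s] by simp
      show "min m m2 \<le> Fw (y s)" using m(2)[OF sub[OF s]] by (simp add: y_def)
    qed
    then show ?thesis by (simp add: y_def)
  qed
  have "\<phi> ` {0..1} = {0..T}"
  proof
    show "{0..T} \<subseteq> \<phi> ` {0..1}"
      using IVT'[of \<phi> 0 _ 1] cont \<phi>01 by force
  qed (use range in blast)
  then show ?thesis
    unfolding reparametrization_of_def using cont eq mono by (intro exI[of _ \<phi>]) (auto intro!: mono_onI)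
qed

end

section \<open>Minimizers\<close>

context calibrated_well
begin

text \<open>
  The speed \<open>1 / F\<close> of the integral curve is unbounded near the origin. With the parameter change
  \<open>\<psi> u = T (1 - (1 - u)\<^sup>2)\<close> one has \<open>r_tilde (\<gamma> u) = r_tilde p0 (1 - u)\<^sup>2\<close>, so \<open>F\<close> is at least a multiple of
  \<open>1 - u\<close>, and the factor \<open>\<psi>' u = 2 T (1 - u)\<close> compensates for the singularity.
\<close>

lemma lipschitz_parametrization_exists:
  assumes \<eta>: "integral_curve_to_origin Vw p0 T \<eta>"
  obtains \<gamma> where "\<gamma> \<in> curves_to_origin p0" "reparametrization_of T \<eta> \<gamma>"
proof -
  define \<psi> where "\<psi> = (\<lambda>u::real. T * (1 - (1 - u)\<^sup>2))"
  define \<gamma> where "\<gamma> = (\<lambda>u. \<eta> (\<psi> u))"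
  have T: "0 < T" "T = rt p0 / sin \<beta>" and ends: "\<eta> 0 = p0" "\<eta> T = 0" and c\<eta>: "continuous_on {0..T} \<eta>"
    using \<eta> integral_curve_level(1)[OF \<eta>] by (auto simp: integral_curve_to_origin_def)
  have r0: "0 < rt p0" using T sin_beta_pos by (metis divide_pos_pos less_irrefl r_tilde_nonneg div_0 order_le_less)
  have c\<psi>: "continuous_on X \<psi>" for X unfolding \<psi>_def by (intro continuous_intros)
  have mono: "\<psi> u \<le> \<psi> v" if "u \<le> v" "v \<le> 1" for u v
    unfolding \<psi>_def using that T(1) by (intro mult_left_mono diff_left_mono power_mono) auto
  have \<psi>01: "\<psi> 0 = 0" "\<psi> 1 = T" by (simp_all add: \<psi>_def)
  have range: "\<psi> u \<in> {0..T}" if "u \<in> {0..1}" for u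
    using mono[of 0 u] mono[of u 1] that \<psi>01 by auto
  have onto: "\<psi> ` {0..1} = {0..T}"
  proof
    show "{0..T} \<subseteq> \<psi> ` {0..1}" using IVT'[of \<psi> 0 _ 1] c\<psi> \<psi>01 by force
  qed (use range in blast)
  define B where "B = 2 * T / sqrt (2 * min l1 l2 * rt p0)"
  have q: "0 < 2 * min l1 l2 * rt p0" using l1_pos l2_pos r0 by simp
  have B: "0 \<le> B" using T(1) q by (simp add: B_def)
  have c\<gamma>: "continuous_on {0..1} \<gamma>"
    unfolding \<gamma>_def by (rule continuous_on_compose2[OF c\<eta> c\<psi>]) (use range in blast)
  have \<gamma>': "(\<gamma> has_vector_derivative (2 * T * (1 - u)) *\<^sub>R Vw (\<gamma> u)) (at u)
      \<and> norm ((2 * T * (1 - u)) *\<^sub>R Vw (\<gamma> u)) \<le> B" if u: "0 < u" "u < 1" for u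
  proof
    have "0 < (1 - u)\<^sup>2" "(1 - u)\<^sup>2 < 1" using u by (simp_all add: power_less_one_iff)
    then have \<psi>u: "\<psi> u \<in> {0<..<T}" using T(1) by (simp add: \<psi>_def)
    then have d: "\<gamma> u \<noteq> 0" "(\<eta> has_vector_derivative Vw (\<gamma> u)) (at (\<psi> u))"
      using \<eta> unfolding integral_curve_to_origin_def \<gamma>_def
      by (auto simp: at_within_Icc_at dest!: bspec[of _ _ "\<psi> u"])
    have "(\<psi> has_vector_derivative 2 * T * (1 - u)) (at u)"
      unfolding \<psi>_def has_real_derivative_iff_has_vector_derivative[symmetric]
      by (auto intro!: derivative_eq_intros)
    from vector_diff_chain_at[OF this d(2)]
    show "(\<gamma> has_vector_derivative (2 * T * (1 - u)) *\<^sub>R Vw (\<gamma> u)) (at u)"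
      by (simp add: \<gamma>_def o_def)
    have "rt (\<gamma> u) = rt p0 * (1 - u)\<^sup>2"
      using integral_curve_level(2)[OF \<eta>, of "\<psi> u"] \<psi>u sin_beta_pos
      by (simp add: \<gamma>_def) (simp add: \<psi>_def T(2) field_simps)
    then have "sqrt (2 * min l1 l2 * (rt p0 * (1 - u)\<^sup>2)) \<le> Fw (\<gamma> u)"
      by (intro F_ge_on_superlevel) simp
    then have F: "sqrt (2 * min l1 l2 * rt p0) * (1 - u) \<le> Fw (\<gamma> u)"
      using u by (simp add: real_sqrt_mult mult.assoc)
    have "norm ((2 * T * (1 - u)) *\<^sub>R Vw (\<gamma> u)) = 2 * T * (1 - u) / Fw (\<gamma> u)"
      using T(1) u by (simp add: abs_mult norm_V)
    also have "\<dots> \<le> 2 * T * (1 - u) / (sqrt (2 * min l1 l2 * rt p0) * (1 - u))"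
      using F T(1) u q by (intro divide_left_mono mult_pos_pos) (auto intro: F_pos[OF d(1)])
    also have "\<dots> = B" using u by (simp add: B_def)
    finally show "norm ((2 * T * (1 - u)) *\<^sub>R Vw (\<gamma> u)) \<le> B" .
  qed
  have "B-lipschitz_on {0..1} \<gamma>"
  proof (rule lipschitz_on_leI[OF _ B])
    fix u v :: real assume uv: "u \<in> {0..1}" "v \<in> {0..1}" "u \<le> v"
    show "dist (\<gamma> u) (\<gamma> v) \<le> B * dist u v"
    proof (cases "u = v")
      case False
      then have "u < v" using uv by simp
      then have "norm (\<gamma> v - \<gamma> u) \<le> B * v - B * u"
      proof (rule differentiable_bound_general)
        show "continuous_on {u..v} \<gamma>" by (rule continuous_on_subset[OF c\<gamma>]) (use uv in auto)
        show "continuous_on {u..v} (\<lambda>x. B * x)" by (intro continuous_intros)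
        fix x assume "u < x" "x < v"
        then show "(\<gamma> has_vector_derivative (2 * T * (1 - x)) *\<^sub>R Vw (\<gamma> x)) (at x)"
          "norm ((2 * T * (1 - x)) *\<^sub>R Vw (\<gamma> x)) \<le> B" using \<gamma>'[of x] uv by auto
        show "((\<lambda>x. B * x) has_vector_derivative B) (at x)"
          unfolding has_real_derivative_iff_has_vector_derivative[symmetric]
          by (auto intro!: derivative_eq_intros)
      qed
      then show ?thesis using uv(3) by (simp add: dist_norm norm_minus_commute right_diff_distrib)
    qed simp
  qed
  then have "\<gamma> \<in> curves_to_origin p0"
    using lipschitz_imp_locally_lipschitz_on
    by (simp add: curves_to_origin_def) (simp add: \<gamma>_def \<psi>01 ends)
  moreover have "reparametrization_of T \<eta> \<gamma>"
    unfolding reparametrization_of_def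
    using c\<psi> onto mono by (intro exI[of _ \<psi>]) (auto simp: \<gamma>_def intro!: mono_onI)
  ultimately show ?thesis by (rule that)
qed

lemma calibrated_iff_reparametrization:
  assumes "\<gamma> \<in> curves_to_origin p0" "integral_curve_to_origin Vw p0 T \<eta>"
  shows "calibrated \<gamma> \<longleftrightarrow> reparametrization_of T \<eta> \<gamma>"
  using assms calibrated_imp_reparametrization reparametrization_imp_calibrated by blast

text \<open>
  If the calibration bound takes the same value on a whole class of curves and is attained by
  one of them, then the minimizers are the calibrated curves. Only the product with \<open>cos \<beta>\<close> has to be
  constant: for \<open>\<beta> = \<pi> / 2\<close> this holds for all curves to the origin, without any area constraint.
\<close>

lemma minimizes_energy_iff_calibrated:
  assumes C: "C \<subseteq> curves_to_origin p0"
    and k: "\<And>\<delta>. \<delta> \<in> C \<Longrightarrow> cos \<beta> * line_integral (omega1 l1 l2) \<delta> = k"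
    and "\<exists>\<delta>\<in>C. calibrated \<delta>"
  shows "minimizes_energy_in l1 l2 C \<gamma> \<longleftrightarrow> \<gamma> \<in> C \<and> calibrated \<gamma>"
proof -
  define c where "c = (l1 + l2) * k + sin \<beta> * rt p0"
  have "c \<le> energy l1 l2 \<delta>" "energy l1 l2 \<delta> = c \<longleftrightarrow> calibrated \<delta>" if "\<delta> \<in> C" for \<delta>
    using energy_lower_bound[of \<delta> p0] k[OF that] C that by (auto simp: c_def mult.assoc)
  then show ?thesis
    unfolding minimizes_energy_in_def using assms(3) by (metis order_antisym)
qed

end

context quadratic_well
begin

text \<open>
  The curve is defined by choice, so its properties depend on a minimizer existing; the calibration with
  \<open>\<beta> = \<pi> / 2\<close> provides one.
\<close>

lemma unconstrained_minimizer_curve: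
  assumes "p0 \<noteq> 0"
  shows "unconstrained_minimizer l1 l2 p0 \<in> curves_to_origin p0"
proof -
  interpret calibrated_well l1 l2 "pi / 2" by unfold_locales simp
  obtain \<eta> where \<eta>: "integral_curve_to_origin Vw p0 (rt p0 / sin (pi / 2)) \<eta>"
    by (rule integral_curve_exists[OF assms]) (rule that)
  obtain \<gamma> where \<gamma>: "\<gamma> \<in> curves_to_origin p0" "reparametrization_of (rt p0 / sin (pi / 2)) \<eta> \<gamma>"
    by (rule lipschitz_parametrization_exists[OF \<eta>]) (rule that)
  then have "calibrated \<gamma>" using calibrated_iff_reparametrization[OF \<gamma>(1) \<eta>] by simp
  then have "minimizes_energy_in l1 l2 (curves_to_origin p0) \<gamma>"
    using minimizes_energy_iff_calibrated[of "curves_to_origin p0" p0 0 \<gamma>] \<gamma>(1) by auto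
  then have "minimizes_energy_in l1 l2 (curves_to_origin p0) (unconstrained_minimizer l1 l2 p0)"
    unfolding unconstrained_minimizer_def
    by (rule someI[where P = "minimizes_energy_in l1 l2 (curves_to_origin p0)"])
  then show ?thesis by (simp add: minimizes_energy_in_def)
qed

text \<open>
  The reduction of the area constraint to a constraint on the integral of \<open>omega1\<close>, on which the
  calibration argument relies: \<open>omega0 - omega1\<close> has the same integral along every curve from \<open>p0\<close> to
  the origin.
\<close>

lemma constrained_curves_eq:
  assumes "p0 \<noteq> 0"
  shows "constrained_curves A p0 =
    {\<gamma> \<in> curves_to_origin p0. line_integral (omega1 l1 l2) \<gamma> = A_tilde l1 l2 A p0}"
  using omega_difference_integral[OF unconstrained_minimizer_curve[OF assms] l1_pos l2_pos]
    area_eq_line_integral[OF _ l1_pos l2_pos]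
  unfolding constrained_curves_def A_tilde_def by force

end

lemma cot_bijection:
  fixes a c :: real
  assumes "0 < c"
  shows "\<exists>!\<beta>. \<beta> \<in> {0<..<pi} \<and> c * cot \<beta> = a"
proof (rule ex1I)
  have cot_eq: "cot \<beta> = tan (pi / 2 - \<beta>)" for \<beta> :: real
    by (simp add: cot_def tan_def sin_diff cos_diff)
  show "pi / 2 - arctan (a / c) \<in> {0<..<pi} \<and> c * cot (pi / 2 - arctan (a / c)) = a"
    using arctan_lbound[of "a / c"] arctan_ubound[of "a / c"] assms by (simp add: cot_eq tan_arctan)
  fix \<beta> assume \<beta>: "\<beta> \<in> {0<..<pi} \<and> c * cot \<beta> = a"
  then have "cot \<beta> = a / c" using assms by (auto simp: field_simps)
  then have "tan (pi / 2 - \<beta>) = a / c" by (simp only: cot_eq)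
  then have "arctan (a / c) = pi / 2 - \<beta>" using \<beta> arctan_tan[of "pi / 2 - \<beta>"] by simp
  then show "\<beta> = pi / 2 - arctan (a / c)" by simp
qed

theorem theorem2p5:
  fixes l1 l2 A :: real and p0 :: "real^2"
  assumes "0 < l1" and "0 < l2" and "p0 \<noteq> 0"
  shows "(\<exists>!\<beta>. \<beta> \<in> {0<..<pi} \<and> r_tilde l1 l2 p0 / (l1 + l2) * cot \<beta> = A_tilde l1 l2 A p0) \<and>
    (\<forall>\<beta>\<in>{0<..<pi}. r_tilde l1 l2 p0 / (l1 + l2) * cot \<beta> = A_tilde l1 l2 A p0 \<longrightarrow>
      (\<exists>T \<eta>.
        integral_curve_to_origin (V_field l1 l2 \<beta>) p0 T \<eta> \<and>
        (\<forall>T' \<eta>'. integral_curve_to_origin (V_field l1 l2 \<beta>) p0 T' \<eta>' \<longrightarrow>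
            T' = T \<and> (\<forall>t\<in>{0..T}. \<eta>' t = \<eta> t)) \<and>
        (\<exists>\<gamma>. minimizes_energy_in l1 l2 (constrained_curves A p0) \<gamma>) \<and>
        (\<forall>\<gamma>. minimizes_energy_in l1 l2 (constrained_curves A p0) \<gamma> \<longleftrightarrow>
            \<gamma> \<in> constrained_curves A p0 \<and> reparametrization_of T \<eta> \<gamma>)))"
proof (intro conjI ballI impI)
  interpret quadratic_well l1 l2 using assms by unfold_locales
  show "\<exists>!\<beta>. \<beta> \<in> {0<..<pi} \<and> r_tilde l1 l2 p0 / (l1 + l2) * cot \<beta> = A_tilde l1 l2 A p0"
    using r_tilde_pos[OF assms(3)] l1_pos l2_pos by (intro cot_bijection) simp
  fix \<beta> :: real
  assume "\<beta> \<in> {0<..<pi}" and \<beta>: "r_tilde l1 l2 p0 / (l1 + l2) * cot \<beta> = A_tilde l1 l2 A p0"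
  then interpret calibrated_well l1 l2 \<beta> by unfold_locales
  define T where "T = r_tilde l1 l2 p0 / sin \<beta>"
  obtain \<eta> where "integral_curve_to_origin (V_field l1 l2 \<beta>) p0 (r_tilde l1 l2 p0 / sin \<beta>) \<eta>"
    by (rule integral_curve_exists[OF assms(3)]) (rule that)
  then have \<eta>: "integral_curve_to_origin (V_field l1 l2 \<beta>) p0 T \<eta>" by (simp add: T_def)
  obtain \<gamma>0 where \<gamma>0: "\<gamma>0 \<in> curves_to_origin p0" "reparametrization_of T \<eta> \<gamma>0"
    by (rule lipschitz_parametrization_exists[OF \<eta>]) (rule that)
  let ?C = "constrained_curves A p0"
  have C: "?C = {\<gamma> \<in> curves_to_origin p0. line_integral (omega1 l1 l2) \<gamma> = r_tilde l1 l2 p0 / (l1 + l2) * cot \<beta>}"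
    using constrained_curves_eq[OF assms(3)] \<beta> by simp
  have \<gamma>0_calibrated: "calibrated \<gamma>0" using calibrated_iff_reparametrization[OF \<gamma>0(1) \<eta>] \<gamma>0(2) by simp
  then have \<gamma>0_C: "\<gamma>0 \<in> ?C" using C calibrated_line_integral[OF \<gamma>0(1)] \<gamma>0(1) by simp
  have sub: "?C \<subseteq> curves_to_origin p0" using C by blast
  have "minimizes_energy_in l1 l2 ?C \<gamma> \<longleftrightarrow> \<gamma> \<in> ?C \<and> calibrated \<gamma>" for \<gamma>
    by (rule minimizes_energy_iff_calibrated[OF sub,
          where k = "cos \<beta> * (r_tilde l1 l2 p0 / (l1 + l2) * cot \<beta>)"])
       (use C \<gamma>0_C \<gamma>0_calibrated in auto)
  then have iff: "minimizes_energy_in l1 l2 ?C \<gamma> \<longleftrightarrow> \<gamma> \<in> ?C \<and> reparametrization_of T \<eta> \<gamma>" for \<gamma>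
    using calibrated_iff_reparametrization[OF _ \<eta>] sub by blast
  show "\<exists>T \<eta>.
        integral_curve_to_origin (V_field l1 l2 \<beta>) p0 T \<eta> \<and>
        (\<forall>T' \<eta>'. integral_curve_to_origin (V_field l1 l2 \<beta>) p0 T' \<eta>' \<longrightarrow>
            T' = T \<and> (\<forall>t\<in>{0..T}. \<eta>' t = \<eta> t)) \<and>
        (\<exists>\<gamma>. minimizes_energy_in l1 l2 ?C \<gamma>) \<and>
        (\<forall>\<gamma>. minimizes_energy_in l1 l2 ?C \<gamma> \<longleftrightarrow> \<gamma> \<in> ?C \<and> reparametrization_of T \<eta> \<gamma>)"
    using \<eta> integral_curve_unique[OF \<eta>] iff \<gamma>0_C \<gamma>0(2) by blast
qed

end
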